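(* Let $G$ be a finitely presented group and $H\le G$ a subgroup. If $H\hookrightarrow_h G$ (that is, $H$ is a hyperbolically embedded subgroup of $G$), then the relative Dehn function $\Delta_{G,H}$ is well-defined.
   Context: **Hyperbolically embedded subgroups** (Dahmani–Guirardel–Osin). Let $X\subseteq G$ be such that $X\cup H$ generates $G$, and let $\Gamma(G,X\sqcup H)$ be the Cayley graph with respect to the alphabet $X\sqcup H$ (disjoint union); it contains the complete Cayley graph $\Gamma(H,H)$ as a subgraph. Define $\hat d\colon H\times H\to[0,\infty]$ by letting $\hat d(h,k)$ be the length of a shortest path in $\Gamma(G,X\sqcup H)$ from $h$ to $k$ that contains no edges of $\Gamma(H,H)$ ($\infty$ if no such path exists). $H\hookrightarrow_h(G,X)$ means that $G$ is generated by $X\cup H$, $\Gamma(G,X\sqcup H)$ is hyperbolic, and every $\hat d$-ball of finite radius in $H$ is finite. $H\hookrightarrow_hG$ means $H\hookrightarrow_h(G,X)$ for some $X\subseteq G$. **Relative Dehn function.** For $S\subseteq G$, $G$ is generated by $S$ relative to $H$ if the natural homomorphism $F=F(S)*H\to G$ is surjective. If $R\subseteq F$ normally generates the kernel, $G=\langle S,H\mid R\rangle$ is a relative presentation; it is finite if $S$ and $R$ are finite, and then $G$ is finitely presented relative to $H$. The relative Dehn function $\Delta_{G,H}$ of the relative presentation is the smallest function on $\mathbb{N}$ (value $\infty$ allowed) such that every word $W$ of length at most $n$ over $S\sqcup(H\setminus\{1\})$ (letters of $S$ may occur with exponent $\pm1$) representing $1$ in $G$ can be written in $F$ as $\prod_{i=1}^kf_i^{-1}R_if_i$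 with $f_i\in F$, $R_i\in R\cup R^{-1}$, $k\le\Delta_{G,H}(n)$. "$\Delta_{G,H}$ is well-defined" means that $G$ is finitely presented relative to $H$ and $\Delta_{G,H}$ takes only finite values with respect to a finite relative presentation (this does not depend on the choice of finite relative presentation). *)

theory Defs
  imports
    "HOL-Algebra.Generated_Groups"
    "HOL-Library.Extended_Nat"
    "Graph_Theory.Arc_Walk"
begin

section \<open>Words modulo relations, free groups and free products\<close>

definition word_step :: "'l set \<Rightarrow> ('l list \<times> 'l list) set \<Rightarrow> ('l list \<times> 'l list) set" where
  "word_step A Q = {(u @ l @ v, u @ r @ v) |u l r v. u \<in> lists A \<and> v \<in> lists A \<and> (l, r) \<in> Q}"

definition word_cong :: "'l set \<Rightarrow> ('l list \<times> 'l list) set \<Rightarrow> ('l list \<times> 'l list) set" where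
  "word_cong A Q = (word_step A Q \<union> (word_step A Q)\<inverse>)\<^sup>* \<inter> lists A \<times> lists A"

definition word_class :: "'l set \<Rightarrow> ('l list \<times> 'l list) set \<Rightarrow> 'l list \<Rightarrow> 'l list set" where
  "word_class A Q w = word_cong A Q `` {w}"

text \<open>The monoid presented by the alphabet \<open>A\<close> and the relations \<open>l = r\<close>, \<open>(l, r) \<in> Q\<close>.
  Its elements are the congruence classes of words.\<close>

definition word_monoid :: "'l set \<Rightarrow> ('l list \<times> 'l list) set \<Rightarrow> 'l list set monoid" where
  "word_monoid A Q = \<lparr>carrier = lists A // word_cong A Q,
     monoid.mult = (\<lambda>K L. \<Union>u\<in>K. \<Union>v\<in>L. word_class A Q (u @ v)),
     one = word_class A Q []\<rparr>"

text \<open>\<open>(s, True)\<close> stands for \<open>s\<close> and \<open>(s, False)\<close> for its formal inverse.\<close>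

definition free_group :: "'s set \<Rightarrow> ('s \<times> bool) list set monoid" where
  "free_group S = word_monoid (S \<times> UNIV) {([(s, b), (s, \<not> b)], []) |s b. s \<in> S}"

text \<open>\<open>Gen s True\<close> and \<open>Gen s False\<close> stand for \<open>s\<close> and its inverse. The type of letters keeps
  \<open>S\<close> and \<open>H\<close> apart, so alphabets are disjoint unions even if \<open>S\<close> and \<open>H\<close> meet.\<close>

datatype ('s, 'h) letter = Gen 's bool | Sub 'h

definition letters :: "'s set \<Rightarrow> 'h set \<Rightarrow> ('s, 'h) letter set" where
  "letters S H = {Gen s b |s b. s \<in> S} \<union> Sub ` H"

definition free_prod_rels ::
  "'s set \<Rightarrow> ('h, 'm) monoid_scheme \<Rightarrow> (('s, 'h) letter list \<times> ('s, 'h) letter list) set" where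
  "free_prod_rels S K =
     {([Gen s b, Gen s (\<not> b)], []) |s b. s \<in> S}
   \<union> {([Sub h, Sub k], [Sub (h \<otimes>\<^bsub>K\<^esub> k)]) |h k. h \<in> carrier K \<and> k \<in> carrier K}
   \<union> {([Sub \<one>\<^bsub>K\<^esub>], [])}"

text \<open>The free product of the free group on \<open>S\<close> with the group \<open>K\<close>.\<close>

definition free_prod :: "'s set \<Rightarrow> ('h, 'm) monoid_scheme \<Rightarrow> ('s, 'h) letter list set monoid" where
  "free_prod S K = word_monoid (letters S (carrier K)) (free_prod_rels S K)"

definition free_prod_class :: "'s set \<Rightarrow> ('h, 'm) monoid_scheme \<Rightarrow> ('s, 'h) letter list \<Rightarrow> ('s, 'h) letter list set" where
  "free_prod_class S K w = word_class (letters S (carrier K)) (free_prod_rels S K) w"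


section \<open>Finite presentations\<close>

definition normal_closure :: "('a, 'm) monoid_scheme \<Rightarrow> 'a set \<Rightarrow> 'a set" where
  "normal_closure G R = \<Inter>{N. N \<lhd> G \<and> R \<subseteq> N}"

definition finitely_presented :: "('a, 'm) monoid_scheme \<Rightarrow> bool" where
  "finitely_presented G \<longleftrightarrow> (\<exists>(S :: nat set) R. finite S \<and> finite R \<and> R \<subseteq> carrier (free_group S) \<and>
     free_group S Mod normal_closure (free_group S) R \<cong> G)"


section \<open>Cayley graphs and hyperbolically embedded subgroups\<close>

fun letter_val :: "('a, 'm) monoid_scheme \<Rightarrow> ('a, 'a) letter \<Rightarrow> 'a" where
  "letter_val G (Gen s b) = (if b then s else inv\<^bsub>G\<^esub> s)"
| "letter_val G (Sub h) = h"

definition word_val :: "('a, 'm) monoid_scheme \<Rightarrow> ('a, 'a) letter list \<Rightarrow> 'a" where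
  "word_val G w = foldr (\<lambda>a x. letter_val G a \<otimes>\<^bsub>G\<^esub> x) w \<one>\<^bsub>G\<^esub>"

text \<open>The arc \<open>(g, a)\<close> is the edge labelled \<open>a\<close> that starts at \<open>g\<close>. The alphabet is closed under
  formal inverses, so directed walks in this digraph are paths in the undirected Cayley graph.\<close>

definition cayley_graph ::
  "('a, 'm) monoid_scheme \<Rightarrow> 'a set \<Rightarrow> 'a set \<Rightarrow> ('a, 'a \<times> ('a, 'a) letter) pre_digraph" where
  "cayley_graph G X H = \<lparr>verts = carrier G, arcs = carrier G \<times> letters X H,
     tail = fst, head = (\<lambda>(g, a). g \<otimes>\<^bsub>G\<^esub> letter_val G a)\<rparr>"

definition graph_dist :: "('v, 'e) pre_digraph \<Rightarrow> 'v \<Rightarrow> 'v \<Rightarrow> enat" where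
  "graph_dist \<Gamma> u v = (INF p \<in> {p. pre_digraph.awalk \<Gamma> u p v}. enat (length p))"

definition geodesic :: "('v, 'e) pre_digraph \<Rightarrow> 'v \<Rightarrow> 'e list \<Rightarrow> 'v \<Rightarrow> bool" where
  "geodesic \<Gamma> u p v \<longleftrightarrow> pre_digraph.awalk \<Gamma> u p v \<and> enat (length p) = graph_dist \<Gamma> u v"

text \<open>Uniformly slim geodesic triangles. As \<open>u\<close>, \<open>v\<close>, \<open>w\<close> can be permuted cyclically, it is enough
  to mention one of the three sides.\<close>

definition hyperbolic_graph :: "('v, 'e) pre_digraph \<Rightarrow> bool" where
  "hyperbolic_graph \<Gamma> \<longleftrightarrow> (\<exists>\<delta> :: nat. \<forall>u v w p q r.
     geodesic \<Gamma> u p v \<and> geodesic \<Gamma> v q w \<and> geodesic \<Gamma> w r u \<longrightarrow>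
     (\<forall>x \<in> set (pre_digraph.awalk_verts \<Gamma> u p).
        \<exists>y \<in> set (pre_digraph.awalk_verts \<Gamma> v q) \<union> set (pre_digraph.awalk_verts \<Gamma> w r).
          graph_dist \<Gamma> x y \<le> enat \<delta>))"

text \<open>The distance on \<open>H\<close> in the Cayley graph with the edges of the complete Cayley graph of \<open>H\<close>
  removed. Edges between elements of \<open>H\<close> labelled by letters from \<open>X\<close> remain.\<close>

definition rel_dist ::
  "('a, 'm) monoid_scheme \<Rightarrow> 'a set \<Rightarrow> 'a set \<Rightarrow> 'a \<Rightarrow> 'a \<Rightarrow> enat" where
  "rel_dist G X H = graph_dist
     (cayley_graph G X H\<lparr>arcs := arcs (cayley_graph G X H) - H \<times> Sub ` H\<rparr>)"

definition hyp_embedded_wrt :: "('a, 'm) monoid_scheme \<Rightarrow> 'a set \<Rightarrow> 'a set \<Rightarrow> bool" where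
  "hyp_embedded_wrt G X H \<longleftrightarrow>
     generate G (X \<union> H) = carrier G \<and>
     hyperbolic_graph (cayley_graph G X H) \<and>
     (\<forall>h \<in> H. \<forall>n :: nat. finite {k \<in> H. rel_dist G X H h k \<le> enat n})"

definition hyp_embedded :: "('a, 'm) monoid_scheme \<Rightarrow> 'a set \<Rightarrow> bool" where
  "hyp_embedded G H \<longleftrightarrow> (\<exists>X \<subseteq> carrier G. hyp_embedded_wrt G X H)"


section \<open>Relative presentations and relative Dehn functions\<close>

definition rel_free :: "('a, 'm) monoid_scheme \<Rightarrow> 'a set \<Rightarrow> 'a set \<Rightarrow> ('a, 'a) letter list set monoid" where
  "rel_free G H S = free_prod S (G\<lparr>carrier := H\<rparr>)"

definition rel_class ::
  "('a, 'm) monoid_scheme \<Rightarrow> 'a set \<Rightarrow> 'a set \<Rightarrow> ('a, 'a) letter list \<Rightarrow> ('a, 'a) letter list set" where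
  "rel_class G H S w = free_prod_class S (G\<lparr>carrier := H\<rparr>) w"

text \<open>The natural homomorphism from \<open>rel_free G H S\<close> to \<open>G\<close>.\<close>

definition rel_hom :: "('a, 'm) monoid_scheme \<Rightarrow> ('a, 'a) letter list set \<Rightarrow> 'a" where
  "rel_hom G K = the_elem (word_val G ` K)"

definition rel_presentation ::
  "('a, 'm) monoid_scheme \<Rightarrow> 'a set \<Rightarrow> 'a set \<Rightarrow> ('a, 'a) letter list set set \<Rightarrow> bool" where
  "rel_presentation G H S R \<longleftrightarrow>
     S \<subseteq> carrier G \<and> R \<subseteq> carrier (rel_free G H S) \<and>
     rel_hom G ` carrier (rel_free G H S) = carrier G \<and>
     normal_closure (rel_free G H S) R = kernel (rel_free G H S) G (rel_hom G)"

text \<open>The list \<open>ps\<close> of pairs \<open>(f, r)\<close> encodes the product of the conjugates \<open>f\<^sup>-\<^sup>1 r f\<close>.\<close>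

definition conj_prod :: "('f, 'm) monoid_scheme \<Rightarrow> ('f \<times> 'f) list \<Rightarrow> 'f" where
  "conj_prod F ps = foldr (\<lambda>(f, r) x. (inv\<^bsub>F\<^esub> f \<otimes>\<^bsub>F\<^esub> r \<otimes>\<^bsub>F\<^esub> f) \<otimes>\<^bsub>F\<^esub> x) ps \<one>\<^bsub>F\<^esub>"

definition rel_dehn ::
  "('a, 'm) monoid_scheme \<Rightarrow> 'a set \<Rightarrow> 'a set \<Rightarrow> ('a, 'a) letter list set set \<Rightarrow> nat \<Rightarrow> enat" where
  "rel_dehn G H S R n = (let F = rel_free G H S in
     LEAST m. \<forall>w \<in> lists (letters S (H - {\<one>\<^bsub>G\<^esub>})).
       length w \<le> n \<and> word_val G w = \<one>\<^bsub>G\<^esub> \<longrightarrow>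
       (\<exists>ps. set ps \<subseteq> carrier F \<times> (R \<union> m_inv F ` R) \<and>
             rel_class G H S w = conj_prod F ps \<and> enat (length ps) \<le> m))"

definition rel_dehn_well_defined :: "('a, 'm) monoid_scheme \<Rightarrow> 'a set \<Rightarrow> bool" where
  "rel_dehn_well_defined G H \<longleftrightarrow> (\<exists>S R. finite S \<and> finite R \<and> rel_presentation G H S R \<and>
     (\<forall>n. rel_dehn G H S R n \<noteq> \<infinity>))"


section \<open>The constructions are groups, and the natural map is a homomorphism\<close>

lemma word_cong_equiv: "equiv (lists A) (word_cong A Q)"
proof (rule equivI)
  show "refl_on (lists A) (word_cong A Q)"
    by (auto simp: refl_on_def word_cong_def)
  have "sym ((word_step A Q \<union> (word_step A Q)\<inverse>)\<^sup>*)"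
    by (intro sym_rtrancl sym_Un_converse)
  then show "sym (word_cong A Q)"
    by (auto simp: word_cong_def sym_def)
  show "trans (word_cong A Q)"
    by (auto simp: word_cong_def trans_def intro: rtrancl_trans)
qed (auto simp: word_cong_def)

lemma word_cong_trans:
  "(u, v) \<in> word_cong A Q \<Longrightarrow> (v, w) \<in> word_cong A Q \<Longrightarrow> (u, w) \<in> word_cong A Q"
  by (auto simp: word_cong_def intro: rtrancl_trans)

lemma word_cong_context:
  assumes "(u, v) \<in> word_cong A Q" "x \<in> lists A" "y \<in> lists A"
  shows "(x @ u @ y, x @ v @ y) \<in> word_cong A Q"
proof -
  let ?T = "word_step A Q \<union> (word_step A Q)\<inverse>"
  have step: "(x @ a @ y, x @ b @ y) \<in> word_step A Q" if ab: "(a, b) \<in> word_step A Q" for a b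
  proof -
    obtain u l r v where *: "a = u @ l @ v" "b = u @ r @ v" "u \<in> lists A" "v \<in> lists A" "(l, r) \<in> Q"
      using ab by (auto simp: word_step_def)
    have "x @ a @ y = (x @ u) @ l @ (v @ y)" "x @ b @ y = (x @ u) @ r @ (v @ y)"
      "x @ u \<in> lists A" "v @ y \<in> lists A"
      using * assms(2,3) by auto
    then show ?thesis
      unfolding word_step_def using *(5) by blast
  qed
  have "(u, v) \<in> ?T\<^sup>*"
    using assms(1) by (simp add: word_cong_def)
  then have "(x @ u @ y, x @ v @ y) \<in> ?T\<^sup>*"
    by (induction rule: rtrancl_induct) (auto intro: step rtrancl_into_rtrancl)
  then show ?thesis
    using assms by (auto simp: word_cong_def)
qed

lemma word_cong_append:
  assumes "(u, u') \<in> word_cong A Q" "(v, v') \<in> word_cong A Q"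
  shows "(u @ v, u' @ v') \<in> word_cong A Q"
proof -
  have "u' \<in> lists A" "v \<in> lists A"
    using assms by (auto simp: word_cong_def)
  then have "(u @ v, u' @ v) \<in> word_cong A Q" "(u' @ v, u' @ v') \<in> word_cong A Q"
    using word_cong_context[OF assms(1), of "[]" v] word_cong_context[OF assms(2), of u' "[]"] by auto
  then show ?thesis
    by (rule word_cong_trans)
qed

lemma word_class_eq_iff:
  assumes "u \<in> lists A" "v \<in> lists A"
  shows "word_class A Q u = word_class A Q v \<longleftrightarrow> (u, v) \<in> word_cong A Q"
  unfolding word_class_def using eq_equiv_class_iff[OF word_cong_equiv assms] .

lemma carrier_word_monoid: "carrier (word_monoid A Q) = word_class A Q ` lists A"
  by (auto simp: word_monoid_def quotient_def word_class_def)

lemma one_word_monoid: "\<one>\<^bsub>word_monoid A Q\<^esub> = word_class A Q []"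
  by (simp add: word_monoid_def)

lemma mult_word_monoid:
  assumes "u \<in> lists A" "v \<in> lists A"
  shows "word_class A Q u \<otimes>\<^bsub>word_monoid A Q\<^esub> word_class A Q v = word_class A Q (u @ v)"
proof -
  have *: "word_class A Q (u' @ v') = word_class A Q (u @ v)"
    if "u' \<in> word_class A Q u" "v' \<in> word_class A Q v" for u' v'
  proof -
    have "(u @ v, u' @ v') \<in> word_cong A Q"
      using that by (auto simp: word_class_def intro: word_cong_append)
    then show ?thesis
      unfolding word_class_def using equiv_class_eq[OF word_cong_equiv] by blast
  qed
  have "u \<in> word_class A Q u" "v \<in> word_class A Q v"
    unfolding word_class_def using assms by (auto simp: word_cong_def)
  then have "(\<Union>u' \<in> word_class A Q u. \<Union>v' \<in> word_class A Q v. word_class A Q (u' @ v')) =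
      word_class A Q (u @ v)"
    using * by blast
  then show ?thesis
    by (simp add: word_monoid_def)
qed

lemma word_cong_rel:
  assumes "(l, r) \<in> Q" "l \<in> lists A" "r \<in> lists A"
  shows "(l, r) \<in> word_cong A Q"
proof -
  have "([] @ l @ [], [] @ r @ []) \<in> word_step A Q"
    unfolding word_step_def using assms(1) by blast
  then show ?thesis
    using assms by (auto simp: word_cong_def)
qed

lemma word_monoid_group:
  assumes inv: "\<And>a. a \<in> A \<Longrightarrow> \<exists>v \<in> lists A. (v @ [a], []) \<in> word_cong A Q"
  shows "group (word_monoid A Q)"
proof (rule groupI)
  have linv: "\<exists>v \<in> lists A. (v @ u, []) \<in> word_cong A Q" if "u \<in> lists A" for u
    using that
  proof (induction u)
    case Nil
    show ?case
      by (intro bexI[of _ "[]"]) (auto simp: word_cong_def)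
  next
    case (Cons a u)
    obtain v where v: "v \<in> lists A" "(v @ u, []) \<in> word_cong A Q"
      using Cons.IH by blast
    obtain w where w: "w \<in> lists A" "(w @ [a], []) \<in> word_cong A Q"
      using inv[OF Cons.hyps(1)] by blast
    have "(v @ (w @ [a]) @ u, v @ [] @ u) \<in> word_cong A Q"
      using word_cong_context[OF w(2) v(1) Cons.hyps(2)] .
    then have "((v @ w) @ a # u, []) \<in> word_cong A Q"
      using word_cong_trans[of _ "v @ u" A Q "[]"] v(2) by simp
    then show ?case
      using v w by (intro bexI[of _ "v @ w"]) auto
  qed
  fix x assume "x \<in> carrier (word_monoid A Q)"
  then obtain u where u: "u \<in> lists A" "x = word_class A Q u"
    by (auto simp: carrier_word_monoid)
  obtain v where v: "v \<in> lists A" "(v @ u, []) \<in> word_cong A Q"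
    using linv[OF u(1)] by blast
  have "word_class A Q v \<otimes>\<^bsub>word_monoid A Q\<^esub> x = \<one>\<^bsub>word_monoid A Q\<^esub>"
    using u v by (simp add: mult_word_monoid one_word_monoid word_class_eq_iff)
  then show "\<exists>y \<in> carrier (word_monoid A Q). y \<otimes>\<^bsub>word_monoid A Q\<^esub> x = \<one>\<^bsub>word_monoid A Q\<^esub>"
    using v by (auto simp: carrier_word_monoid)
next
  show "\<one>\<^bsub>word_monoid A Q\<^esub> \<in> carrier (word_monoid A Q)"
    by (simp add: carrier_word_monoid one_word_monoid)
next
  fix x y assume "x \<in> carrier (word_monoid A Q)" "y \<in> carrier (word_monoid A Q)"
  then obtain u v where "u \<in> lists A" "v \<in> lists A" "x = word_class A Q u" "y = word_class A Q v"
    by (auto simp: carrier_word_monoid)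
  then show "x \<otimes>\<^bsub>word_monoid A Q\<^esub> y \<in> carrier (word_monoid A Q)"
    by (simp add: carrier_word_monoid mult_word_monoid)
next
  fix x y z
  assume "x \<in> carrier (word_monoid A Q)" "y \<in> carrier (word_monoid A Q)"
    "z \<in> carrier (word_monoid A Q)"
  then obtain u v w where "u \<in> lists A" "v \<in> lists A" "w \<in> lists A"
    "x = word_class A Q u" "y = word_class A Q v" "z = word_class A Q w"
    by (auto simp: carrier_word_monoid)
  then show "x \<otimes>\<^bsub>word_monoid A Q\<^esub> y \<otimes>\<^bsub>word_monoid A Q\<^esub> z =
      x \<otimes>\<^bsub>word_monoid A Q\<^esub> (y \<otimes>\<^bsub>word_monoid A Q\<^esub> z)"
    by (simp add: mult_word_monoid)
next
  fix x assume "x \<in> carrier (word_monoid A Q)"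
  then obtain u where "u \<in> lists A" "x = word_class A Q u"
    by (auto simp: carrier_word_monoid)
  then show "\<one>\<^bsub>word_monoid A Q\<^esub> \<otimes>\<^bsub>word_monoid A Q\<^esub> x = x"
    by (simp add: one_word_monoid mult_word_monoid)
qed

lemma free_group_group: "group (free_group S)"
  unfolding free_group_def
proof (rule word_monoid_group)
  let ?Q = "{([(s, b), (s, \<not> b)], []) |s b. s \<in> S}"
  fix a assume a: "a \<in> S \<times> (UNIV :: bool set)"
  obtain s b where sb: "a = (s, b)"
    by (cases a)
  have "([(s, \<not> b), (s, \<not> \<not> b)], []) \<in> ?Q"
    using a sb by (intro CollectI exI[of _ s] exI[of _ "\<not> b"]) simp
  then have "([(s, \<not> b), (s, b)], []) \<in> ?Q"
    by (simp only: not_not)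
  then have "([(s, \<not> b), (s, b)], []) \<in> word_cong (S \<times> UNIV) ?Q"
    using a sb by (intro word_cong_rel) simp_all
  then show "\<exists>v \<in> lists (S \<times> UNIV). (v @ [a], []) \<in> word_cong (S \<times> UNIV) ?Q"
    using a sb by (intro bexI[of _ "[(s, \<not> b)]"]) (simp_all only: append.simps, simp)
qed

lemma Gen_letters [simp]: "Gen s b \<in> letters S H \<longleftrightarrow> s \<in> S"
  and Sub_letters [simp]: "Sub h \<in> letters S H \<longleftrightarrow> h \<in> H"
  by (auto simp: letters_def)

lemma free_prod_rels_Gen: "s \<in> S \<Longrightarrow> ([Gen s (\<not> b), Gen s b], []) \<in> free_prod_rels S K"
proof -
  assume "s \<in> S"
  then have "([Gen s (\<not> b), Gen s (\<not> \<not> b)], []) \<in> free_prod_rels S K"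
    unfolding free_prod_rels_def
    by (intro UnI1 CollectI exI[of _ s] exI[of _ "\<not> b"]) simp
  then show ?thesis
    by (simp only: not_not)
qed

lemma free_prod_rels_Sub:
  "h \<in> carrier K \<Longrightarrow> k \<in> carrier K \<Longrightarrow> ([Sub h, Sub k], [Sub (h \<otimes>\<^bsub>K\<^esub> k)]) \<in> free_prod_rels S K"
  unfolding free_prod_rels_def by blast

lemma free_prod_rels_one: "([Sub \<one>\<^bsub>K\<^esub>], []) \<in> free_prod_rels S K"
  unfolding free_prod_rels_def by blast

lemma free_prod_group:
  assumes "group K"
  shows "group (free_prod S K)"
  unfolding free_prod_def
proof (rule word_monoid_group)
  interpret K: group K by fact
  let ?A = "letters S (carrier K)" and ?Q = "free_prod_rels S K"
  fix a assume a: "a \<in> ?A"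
  show "\<exists>v \<in> lists ?A. (v @ [a], []) \<in> word_cong ?A ?Q"
  proof (cases a)
    case (Gen s b)
    have "([Gen s (\<not> b), Gen s b], []) \<in> word_cong ?A ?Q"
      using a Gen by (intro word_cong_rel free_prod_rels_Gen) simp_all
    then show ?thesis
      using a Gen by (intro bexI[of _ "[Gen s (\<not> b)]"]) simp_all
  next
    case (Sub h)
    have h: "h \<in> carrier K"
      using a Sub by simp
    have "([Sub (inv\<^bsub>K\<^esub> h), Sub h], [Sub (inv\<^bsub>K\<^esub> h \<otimes>\<^bsub>K\<^esub> h)]) \<in> word_cong ?A ?Q"
      using h by (intro word_cong_rel free_prod_rels_Sub) simp_all
    moreover have "([Sub (inv\<^bsub>K\<^esub> h \<otimes>\<^bsub>K\<^esub> h)], []) \<in> word_cong ?A ?Q"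
      using h free_prod_rels_one by (intro word_cong_rel) simp_all
    ultimately have "([Sub (inv\<^bsub>K\<^esub> h), Sub h], []) \<in> word_cong ?A ?Q"
      by (rule word_cong_trans)
    then show ?thesis
      using h Sub by (intro bexI[of _ "[Sub (inv\<^bsub>K\<^esub> h)]"]) simp_all
  qed
qed

lemma rel_free_group:
  assumes "group G" "subgroup H G"
  shows "group (rel_free G H S)"
  unfolding rel_free_def using assms by (intro free_prod_group subgroup.subgroup_is_group)

context
  fixes G :: "('a, 'm) monoid_scheme" and H S :: "'a set"
  assumes G: "group G" and H: "subgroup H G" and S: "S \<subseteq> carrier G"
begin

interpretation group G by (rule G)

lemma letter_val_closed: "a \<in> letters S H \<Longrightarrow> letter_val G a \<in> carrier G"
  using S subgroup.mem_carrier[OF H] by (auto simp: letters_def)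

lemma word_val_closed: "w \<in> lists (letters S H) \<Longrightarrow> word_val G w \<in> carrier G"
  by (induction w) (auto simp: word_val_def letter_val_closed)

lemma word_val_append:
  assumes "u \<in> lists (letters S H)" "v \<in> lists (letters S H)"
  shows "word_val G (u @ v) = word_val G u \<otimes>\<^bsub>G\<^esub> word_val G v"
  using assms(1)
proof (induction u)
  case Nil
  then show ?case
    using word_val_closed[OF assms(2)] by (simp add: word_val_def)
next
  case (Cons a u)
  then show ?case
    using word_val_closed[OF assms(2)] word_val_closed[of u] letter_val_closed[of a]
    by (simp add: word_val_def m_assoc)
qed

lemma word_val_step:
  assumes "(u, v) \<in> word_step (letters S H)
    (free_prod_rels S (G\<lparr>carrier := H\<rparr>))"
  shows "word_val G u = word_val G v"
proof -
  obtain x l r y where *: "u = x @ l @ y" "v = x @ r @ y"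
    "x \<in> lists (letters S H)" "y \<in> lists (letters S H)"
    "(l, r) \<in> free_prod_rels S (G\<lparr>carrier := H\<rparr>)"
    using assms by (auto simp: word_step_def)
  have "l \<in> lists (letters S H) \<and> r \<in> lists (letters S H) \<and> word_val G l = word_val G r"
    using *(5) S subgroup.mem_carrier[OF H] subgroup.m_closed[OF H] subgroup.one_closed[OF H]
    by (auto simp: free_prod_rels_def letters_def word_val_def)
  then show ?thesis
    using * by (simp add: word_val_append)
qed

lemma rel_hom_class:
  assumes "w \<in> lists (letters S H)"
  shows "rel_hom G (rel_class G H S w) = word_val G w"
proof -
  let ?T = "word_step (letters S H) (free_prod_rels S (G\<lparr>carrier := H\<rparr>))"
  have "word_val G w = word_val G v" if "(w, v) \<in> (?T \<union> ?T\<inverse>)\<^sup>*" for v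
    using that by (induction rule: rtrancl_induct) (auto dest: word_val_step)
  then have "word_val G ` rel_class G H S w = {word_val G w}"
    using assms by (auto simp: rel_class_def free_prod_class_def word_class_def word_cong_def)
  then show ?thesis
    by (simp add: rel_hom_def)
qed

lemma carrier_rel_free: "carrier (rel_free G H S) = rel_class G H S ` lists (letters S H)"
  by (auto simp: rel_free_def rel_class_def free_prod_def free_prod_class_def carrier_word_monoid)

lemma rel_class_append:
  assumes "u \<in> lists (letters S H)" "v \<in> lists (letters S H)"
  shows "rel_class G H S u \<otimes>\<^bsub>rel_free G H S\<^esub> rel_class G H S v = rel_class G H S (u @ v)"
  using assms by (simp add: rel_free_def rel_class_def free_prod_def free_prod_class_def mult_word_monoid)

lemma rel_hom_hom: "rel_hom G \<in> hom (rel_free G H S) G"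
proof (rule homI)
  fix x assume "x \<in> carrier (rel_free G H S)"
  then obtain u where "u \<in> lists (letters S H)" "x = rel_class G H S u"
    by (auto simp: carrier_rel_free)
  then show "rel_hom G x \<in> carrier G"
    by (simp add: rel_hom_class word_val_closed)
next
  fix x y assume "x \<in> carrier (rel_free G H S)" "y \<in> carrier (rel_free G H S)"
  then obtain u v where "u \<in> lists (letters S H)" "v \<in> lists (letters S H)"
    "x = rel_class G H S u" "y = rel_class G H S v"
    by (auto simp: carrier_rel_free)
  then show "rel_hom G (x \<otimes>\<^bsub>rel_free G H S\<^esub> y) = rel_hom G x \<otimes>\<^bsub>G\<^esub> rel_hom G y"
    by (simp add: rel_hom_class rel_class_append word_val_append)
qed

end

end

theory Submission
  imports Defs "HOL-Algebra.Zassenhaus"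
begin

text \<open>Only finitely many letters of \<open>X \<union> H\<close> are needed to generate \<open>G\<close>. Slimness of triangles
  shows that the nearest-point projections to \<open>H\<close> of two vertices that are joined by an edge
  outside \<open>\<Gamma>(H, H)\<close> are at uniformly bounded distance in \<open>rel_dist\<close>. Projecting a path from \<open>1\<close>
  to \<open>h \<in> H\<close> writes \<open>h\<close> as a product of elements of a finite ball, so \<open>H\<close> is finitely
  generated, and the finite presentation of \<open>G\<close> yields a finite relative one with generators in \<open>X\<close>.

  The area of words of length \<open>n\<close> is bounded by induction on \<open>n\<close>, without hyperbolicity. If some
  letter \<open>h\<close> of a word that represents \<open>1\<close> lies outside a ball of radius \<open>n\<close>, the rest of the loop
  must use another edge of the coset of this letter; cutting the loop there gives two shorter
  words that represent \<open>1\<close>. The words all of whose letters lie in the ball are finite in number.\<close>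

section \<open>Lifting homomorphisms and finite presentations\<close>

text \<open>Universal property of a presented monoid, on the level of words. Evaluation turns
  concatenation into multiplication, so a relation that holds for the values also holds inside any
  context.\<close>

lemma word_cong_foldr:
  fixes M (structure)
  assumes "monoid M" and f: "f \<in> A \<rightarrow> carrier M"
    and Q: "\<And>l r. (l, r) \<in> Q \<Longrightarrow> l \<in> lists A \<and> r \<in> lists A \<and>
      foldr (\<lambda>a x. f a \<otimes> x) l \<one> = foldr (\<lambda>a x. f a \<otimes> x) r \<one>"
    and "(u, v) \<in> word_cong A Q"
  shows "foldr (\<lambda>a x. f a \<otimes> x) u \<one> = foldr (\<lambda>a x. f a \<otimes> x) v \<one>"
proof -
  interpret monoid M by fact
  let ?e = "\<lambda>w. foldr (\<lambda>a x. f a \<otimes> x) w \<one>"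
  have closed: "?e w \<in> carrier M" if "w \<in> lists A" for w
    using that f by (induction w) auto
  have append: "?e (x @ y) = ?e x \<otimes> ?e y" if "x \<in> lists A" "y \<in> lists A" for x y
    using that(1)
  proof (induction x)
    case (Cons a x)
    then have "f a \<in> carrier M" using f by auto
    then show ?case
      using Cons closed[OF that(2)] closed[of x] by (simp add: m_assoc)
  qed (simp add: closed[OF that(2)])
  have step: "?e x = ?e y" if xy: "(x, y) \<in> word_step A Q" for x y
  proof -
    obtain p l r q where *: "x = p @ l @ q" "y = p @ r @ q" "p \<in> lists A" "q \<in> lists A" "(l, r) \<in> Q"
      using xy by (auto simp: word_step_def)
    then show ?thesis
      using Q[of l r] by (simp add: append del: foldr_append)
  qed
  have "?e x = ?e y" if "(x, y) \<in> (word_step A Q \<union> (word_step A Q)\<inverse>)\<^sup>*" for x y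
    using that by (induction rule: rtrancl_induct) (auto dest: step)
  then show ?thesis
    using assms(4) by (simp add: word_cong_def)
qed

definition free_group_gen :: "'s set \<Rightarrow> 's \<Rightarrow> ('s \<times> bool) list set" where
  "free_group_gen S s =
     word_class (S \<times> UNIV) {([(s, b), (s, \<not> b)], []) |s b. s \<in> S} [(s, True)]"

lemma free_group_gen_closed [simp]:
  "s \<in> S \<Longrightarrow> free_group_gen S s \<in> carrier (free_group S)"
  by (simp add: free_group_gen_def free_group_def carrier_word_monoid)

text \<open>Induction on words; the letter \<open>(s, False)\<close> cancels against
  \<open>(s, True)\<close> and so represents the inverse of a generator.\<close>

lemma carrier_free_group: "carrier (free_group S) = generate (free_group S) (free_group_gen S ` S)"
proof -
  let ?F = "free_group S" and ?A = "S \<times> (UNIV :: bool set)"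
    and ?Q = "{([(s, b), (s, \<not> b)], []) |s b. s \<in> S}"
  interpret F: group ?F by (rule free_group_group)
  let ?c = "word_class ?A ?Q"
  have F: "?F = word_monoid ?A ?Q" by (simp add: free_group_def)
  have sub: "free_group_gen S ` S \<subseteq> carrier ?F" by auto
  have gen: "?c [(s, b)] \<in> generate ?F (free_group_gen S ` S)" if "s \<in> S" for s b
  proof (cases b)
    case True
    then show ?thesis
      using that by (auto simp: free_group_gen_def intro!: generate.incl)
  next
    case False
    have "([(s, False), (s, \<not> False)], []) \<in> ?Q"
      using that by blast
    then have "([(s, False), (s, True)], []) \<in> word_cong ?A ?Q"
      using that by (intro word_cong_rel) simp_all
    then have "?c [(s, False)] \<otimes>\<^bsub>?F\<^esub> free_group_gen S s = \<one>\<^bsub>?F\<^esub>"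
      using that by (simp add: F free_group_gen_def one_word_monoid mult_word_monoid word_class_eq_iff)
    moreover have "?c [(s, False)] \<in> carrier ?F"
      using that by (simp add: F carrier_word_monoid)
    ultimately have "?c [(s, False)] = inv\<^bsub>?F\<^esub> free_group_gen S s"
      using that F.inv_equality by simp
    then show ?thesis
      using that False by (auto intro: generate.inv)
  qed
  have "?c w \<in> generate ?F (free_group_gen S ` S)" if "w \<in> lists ?A" for w
    using that
  proof (induction w)
    case Nil
    show ?case using generate.one[of ?F] by (simp add: F one_word_monoid)
  next
    case (Cons a w)
    then have "?c (a # w) = ?c [a] \<otimes>\<^bsub>?F\<^esub> ?c w"
      using mult_word_monoid[of "[a]" ?A w ?Q] by (simp add: F)
    then show ?case
      using Cons gen by (auto intro: generate.eng)
  qed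
  then show ?thesis
    using F.generate_incl[OF sub] by (auto simp: F carrier_word_monoid)
qed

lemma free_group_lift:
  assumes "group K" and f: "f \<in> S \<rightarrow> carrier K"
  obtains \<psi> where "\<psi> \<in> hom (free_group S) K" "\<And>s. s \<in> S \<Longrightarrow> \<psi> (free_group_gen S s) = f s"
proof -
  interpret K: group K by fact
  let ?A = "S \<times> (UNIV :: bool set)" and ?Q = "{([(s, b), (s, \<not> b)], []) |s b. s \<in> S}"
  let ?c = "word_class ?A ?Q"
  have F: "free_group S = word_monoid ?A ?Q" by (simp add: free_group_def)
  define g where "g = (\<lambda>(s, b). if b then f s else inv\<^bsub>K\<^esub> f s)"
  define e where "e w = foldr (\<lambda>a x. g a \<otimes>\<^bsub>K\<^esub> x) w \<one>\<^bsub>K\<^esub>" for w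
  have g: "g \<in> ?A \<rightarrow> carrier K" using f by (auto simp: g_def Pi_def)
  have closed: "e w \<in> carrier K" if "w \<in> lists ?A" for w
    using that g unfolding e_def by (induction w) auto
  have append: "e (x @ y) = e x \<otimes>\<^bsub>K\<^esub> e y" if "x \<in> lists ?A" "y \<in> lists ?A" for x y
    using that(1)
  proof (induction x)
    case Nil
    then show ?case using closed[OF that(2)] by (simp add: e_def)
  next
    case (Cons a x)
    then have "g a \<in> carrier K" using g by auto
    then show ?case
      using Cons closed[OF that(2)] closed[of x] by (simp add: e_def K.m_assoc)
  qed
  have "e u = e v" if "(u, v) \<in> word_cong ?A ?Q" for u v
    unfolding e_def
  proof (rule word_cong_foldr[OF K.monoid_axioms g _ that], goal_cases)
    case (1 l r)
    then obtain s b where "s \<in> S" "l = [(s, b), (s, \<not> b)]" "r = []" by blast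
    then show ?case using f by (cases b) (auto simp: g_def Pi_def)
  qed
  then have e_class: "e ` ?c w = {e w}" if "w \<in> lists ?A" for w
    using that word_cong_equiv[of ?A ?Q] unfolding word_class_def
    by (auto simp: equiv_def refl_on_def image_iff)
  \<comment> \<open>As \<open>e\<close> is constant on every class, the image of a class is a
    singleton and no representative has to be chosen.\<close>
  define \<psi> where "\<psi> = (\<lambda>C. the_elem (e ` C))"
  have \<psi>: "\<psi> (?c w) = e w" if "w \<in> lists ?A" for w
    using e_class[OF that] by (simp add: \<psi>_def)
  have "\<psi> \<in> hom (free_group S) K"
  proof (rule homI)
    fix x assume "x \<in> carrier (free_group S)"
    then obtain u where "u \<in> lists ?A" "x = ?c u"
      unfolding F carrier_word_monoid by blast
    then show "\<psi> x \<in> carrier K" by (simp only: \<psi> closed)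
    fix y assume "y \<in> carrier (free_group S)"
    then obtain v where "v \<in> lists ?A" "y = ?c v"
      unfolding F carrier_word_monoid by blast
    then show "\<psi> (x \<otimes>\<^bsub>free_group S\<^esub> y) = \<psi> x \<otimes>\<^bsub>K\<^esub> \<psi> y"
      using \<open>u \<in> lists ?A\<close> \<open>x = ?c u\<close>
      by (simp only: F mult_word_monoid \<psi> append append_in_lists_conv simp_thms)
  qed
  moreover have "\<psi> (free_group_gen S s) = f s" if "s \<in> S" for s
    using that f \<psi>[of "[(s, True)]"] by (auto simp: free_group_gen_def e_def g_def Pi_def)
  ultimately show thesis using that by blast
qed

lemma (in group_hom) eq_on_generate:
  assumes "k \<in> hom G H" "Z \<subseteq> carrier G" "\<And>z. z \<in> Z \<Longrightarrow> h z = k z" "x \<in> generate G Z"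
  shows "h x = k x"
proof -
  interpret k: group_hom G H k
    using assms(1) by unfold_locales
  have "x \<in> generate G Z \<Longrightarrow> h x = k x"
  proof (induction rule: generate.induct)
    case (inv z)
    then show ?case using assms(2,3) by (metis hom_inv k.hom_inv subsetD)
  next
    case (eng a b)
    then show ?case using assms(2) by (simp add: G.generate_in_carrier)
  qed (simp_all add: assms(3))
  then show ?thesis using assms(4) .
qed

lemma (in group) normal_normal_closure:
  assumes "R \<subseteq> carrier G"
  shows "normal_closure G R \<lhd> G"
proof -
  let ?A = "{N. N \<lhd> G \<and> R \<subseteq> N}"
  \<comment> \<open>The whole group shows that the family to be intersected is non-empty.\<close>
  have "carrier G \<lhd> G"
    by (simp add: normal_inv_iff subgroup_self)
  then have "?A \<noteq> {}" using assms by blast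
  moreover have "subgroup N G" if "N \<in> ?A" for N
    using that by (simp add: normal_imp_subgroup)
  ultimately have "subgroup (normal_closure G R) G"
    unfolding normal_closure_def by (intro subgroups_Inter) auto
  then show ?thesis
    by (auto simp: normal_inv_iff normal_closure_def)
qed

lemma normal_closure_incl: "R \<subseteq> normal_closure G R"
  by (auto simp: normal_closure_def)

lemma normal_closure_minimal: "N \<lhd> G \<Longrightarrow> R \<subseteq> N \<Longrightarrow> normal_closure G R \<subseteq> N"
  by (auto simp: normal_closure_def)

text \<open>The epimorphism is the quotient map followed by the isomorphism with \<open>G\<close>.
  In this form generators and relators can be carried over to another group that maps onto
  \<open>G\<close>.\<close>

lemma finitely_presented_hom:
  assumes "group G" "finitely_presented G"
  obtains S :: "nat set" and R \<phi> where "finite S" "finite R" "R \<subseteq> carrier (free_group S)"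
    "\<phi> \<in> hom (free_group S) G" "\<phi> ` carrier (free_group S) = carrier G"
    "kernel (free_group S) G \<phi> = normal_closure (free_group S) R"
proof -
  obtain S :: "nat set" and R where SR: "finite S" "finite R" "R \<subseteq> carrier (free_group S)"
    "free_group S Mod normal_closure (free_group S) R \<cong> G"
    using assms(2) by (auto simp: finitely_presented_def)
  let ?F = "free_group S" and ?N = "normal_closure (free_group S) R"
  interpret F: group ?F by (rule free_group_group)
  interpret N: normal ?N ?F using F.normal_normal_closure[OF SR(3)] .
  obtain \<theta> where \<theta>: "\<theta> \<in> iso (?F Mod ?N) G"
    using SR(4) by (auto simp: is_iso_def)
  let ?q = "\<lambda>x. ?N #>\<^bsub>?F\<^esub> x"
  have q: "?q \<in> hom ?F (?F Mod ?N)" by (rule N.r_coset_hom_Mod)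
  have qs: "?q ` carrier ?F = carrier (?F Mod ?N)"
    by (auto simp: FactGroup_def RCOSETS_def)
  have hom: "\<theta> \<circ> ?q \<in> hom ?F G"
    using Group.hom_compose[OF q] \<theta> by (auto simp: iso_def)
  moreover have "(\<theta> \<circ> ?q) ` carrier ?F = carrier G"
    using \<theta> qs by (auto simp: iso_def bij_betw_def simp flip: image_image)
  moreover have "kernel ?F G (\<theta> \<circ> ?q) = ?N"
  proof -
    interpret Q: group "?F Mod ?N" by (rule N.factorgroup_is_group)
    interpret G: group G by fact
    interpret \<theta>: group_hom "?F Mod ?N" G \<theta>
      using \<theta> by unfold_locales (simp add: iso_def)
    have inj: "inj_on \<theta> (carrier (?F Mod ?N))" using \<theta> by (simp add: iso_def bij_betw_def)
    have "\<theta> (?q x) = \<one>\<^bsub>G\<^esub> \<longleftrightarrow> x \<in> ?N" if x: "x \<in> carrier ?F" for x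
    proof -
      have "?q x \<in> carrier (?F Mod ?N)" using x qs by blast
      then have "\<theta> (?q x) = \<one>\<^bsub>G\<^esub> \<longleftrightarrow> ?q x = \<one>\<^bsub>?F Mod ?N\<^esub>"
        using inj_onD[OF inj, of "?q x" "\<one>\<^bsub>?F Mod ?N\<^esub>"] \<theta>.hom_one Q.one_closed by metis
      also have "\<dots> \<longleftrightarrow> ?q x = ?N" by (simp add: FactGroup_def)
      also have "\<dots> \<longleftrightarrow> x \<in> ?N"
        using x F.coset_join1[OF _ x N.subgroup_axioms] F.coset_join2[OF x N.subgroup_axioms] by blast
      finally show ?thesis .
    qed
    then show ?thesis using N.subset by (auto simp: kernel_def)
  qed
  ultimately show thesis using that SR by blast
qed

text \<open>Every element of a generated subgroup uses only finitely many generators. This is how a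
  finite part of \<open>X \<union> H\<close> is extracted.\<close>

lemma (in group) finite_subset_generate:
  assumes "finite A" "A \<subseteq> generate G Z"
  obtains Z0 where "finite Z0" "Z0 \<subseteq> Z" "A \<subseteq> generate G Z0"
proof -
  have single: "\<exists>Z0 \<subseteq> Z. finite Z0 \<and> a \<in> generate G Z0" if "a \<in> generate G Z" for a
    using that
  proof (induction rule: generate.induct)
    case one
    show ?case by (intro exI[of _ "{}"]) (auto intro: generate.one)
  next
    case (incl h)
    then show ?case by (intro exI[of _ "{h}"]) (auto intro: generate.incl)
  next
    case (inv h)
    then show ?case by (intro exI[of _ "{h}"]) (auto intro: generate.inv)
  next
    case (eng a b)
    then obtain Y Y' where "Y \<subseteq> Z" "finite Y" "a \<in> generate G Y" "Y' \<subseteq> Z" "finite Y'" "b \<in> generate G Y'"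
      by blast
    then show ?case
      using mono_generate[of Y "Y \<union> Y'"] mono_generate[of Y' "Y \<union> Y'"]
      by (intro exI[of _ "Y \<union> Y'"]) (auto intro: generate.eng)
  qed
  then obtain f where f: "\<And>a. a \<in> A \<Longrightarrow> f a \<subseteq> Z \<and> finite (f a) \<and> a \<in> generate G (f a)"
    using assms(2) by (metis subsetD)
  show thesis
  proof
    show "finite (\<Union>a\<in>A. f a)" "(\<Union>a\<in>A. f a) \<subseteq> Z" using f assms(1) by auto
    show "A \<subseteq> generate G (\<Union>a\<in>A. f a)"
      using f mono_generate[of "f _" "\<Union>a\<in>A. f a"] by blast
  qed
qed

section \<open>Nearest-point projections in the Cayley graph\<close>

lemma relpow_sym:
  assumes "\<And>u v. (u, v) \<in> r \<Longrightarrow> (v, u) \<in> r" "(u, v) \<in> r ^^ n"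
  shows "(v, u) \<in> r ^^ n"
  using assms(2)
proof (induction n arbitrary: v)
  case (Suc n)
  then obtain w where "(u, w) \<in> r ^^ n" "(w, v) \<in> r" by auto
  then show ?case using Suc.IH assms(1) by (meson relpow_Suc_I2)
qed simp

lemma relpow_trans: "(x, y) \<in> r ^^ m \<Longrightarrow> (y, z) \<in> r ^^ n \<Longrightarrow> (x, z) \<in> r ^^ (m + n)"
  unfolding relpow_add by (rule relcompI)

definition graph_step :: "('v, 'e) pre_digraph \<Rightarrow> ('v \<times> 'v) set" where
  "graph_step \<Gamma> = {(tail \<Gamma> e, head \<Gamma> e) |e. e \<in> arcs \<Gamma>}"

lemma awalk_relpow:
  assumes "wf_digraph \<Gamma>" "u \<in> verts \<Gamma>"
  shows "(\<exists>p. pre_digraph.awalk \<Gamma> u p v \<and> length p = n) \<longleftrightarrow> (u, v) \<in> graph_step \<Gamma> ^^ n"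
  using assms(2)
proof (induction n arbitrary: u)
  case 0
  then show ?case
    by (auto simp: pre_digraph.awalk_def pre_digraph.cas.simps)
next
  case (Suc n)
  interpret wf_digraph \<Gamma> by fact
  have "(\<exists>p. awalk u p v \<and> length p = Suc n) \<longleftrightarrow>
      (\<exists>e \<in> arcs \<Gamma>. tail \<Gamma> e = u \<and> (\<exists>p. awalk (head \<Gamma> e) p v \<and> length p = n))"
    (is "?L \<longleftrightarrow> ?R")
  proof
    assume ?L
    then obtain e p where "awalk u (e # p) v" "length p = n"
      by (auto simp: length_Suc_conv)
    then show ?R by (auto simp: awalk_def)
  next
    assume ?R
    then obtain e p where "e \<in> arcs \<Gamma>" "tail \<Gamma> e = u" "awalk (head \<Gamma> e) p v" "length p = n"
      by blast
    then show ?L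
      using Suc.prems by (intro exI[of _ "e # p"]) (auto simp: awalk_def)
  qed
  also have "\<dots> \<longleftrightarrow> (\<exists>e \<in> arcs \<Gamma>. tail \<Gamma> e = u \<and> (head \<Gamma> e, v) \<in> graph_step \<Gamma> ^^ n)"
    using Suc.IH by auto
  also have "\<dots> \<longleftrightarrow> (u, v) \<in> graph_step \<Gamma> ^^ Suc n"
    by (auto simp: graph_step_def relpow_commute relcomp_unfold simp del: relpow.simps(2)
        dest: relpow_Suc_D2 intro!: relpow_Suc_I2)
  finally show ?case .
qed

lemma graph_dist_le_iff:
  assumes "wf_digraph \<Gamma>" "u \<in> verts \<Gamma>"
  shows "graph_dist \<Gamma> u v \<le> enat n \<longleftrightarrow> (\<exists>k \<le> n. (u, v) \<in> graph_step \<Gamma> ^^ k)"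
proof
  assume le: "graph_dist \<Gamma> u v \<le> enat n"
  let ?L = "(\<lambda>p. enat (length p)) ` {p. pre_digraph.awalk \<Gamma> u p v}"
  \<comment> \<open>The infimum over no walks would be \<infinity>, so some walk exists; since
    \<open>enat\<close> is well-ordered, the infimum is attained.\<close>
  have "?L \<noteq> {}"
  proof
    assume "?L = {}"
    then have "graph_dist \<Gamma> u v = \<infinity>"
      unfolding graph_dist_def by (simp only: Inf_empty top_enat_def)
    then show False using le by simp
  qed
  then have "graph_dist \<Gamma> u v \<in> ?L"
    unfolding graph_dist_def by (metis ex_in_conv wellorder_InfI)
  then obtain p where "pre_digraph.awalk \<Gamma> u p v" "enat (length p) \<le> enat n"
    using le by (metis (no_types, lifting) imageE mem_Collect_eq)
  then have "(u, v) \<in> graph_step \<Gamma> ^^ length p" "length p \<le> n"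
    using awalk_relpow[OF assms] by auto
  then show "\<exists>k \<le> n. (u, v) \<in> graph_step \<Gamma> ^^ k" by blast
next
  assume "\<exists>k \<le> n. (u, v) \<in> graph_step \<Gamma> ^^ k"
  then obtain k where k: "k \<le> n" "(u, v) \<in> graph_step \<Gamma> ^^ k" by blast
  then have "\<exists>p. pre_digraph.awalk \<Gamma> u p v \<and> length p = k"
    using awalk_relpow[OF assms] by simp
  then obtain p where "pre_digraph.awalk \<Gamma> u p v" "length p \<le> n"
    using k(1) by auto
  then show "graph_dist \<Gamma> u v \<le> enat n"
    unfolding graph_dist_def by (auto intro: INF_lower2)
qed

lemma cas_relpow:
  "pre_digraph.cas \<Gamma> u p v \<Longrightarrow> set p \<subseteq> arcs \<Gamma> \<Longrightarrow> (u, v) \<in> graph_step \<Gamma> ^^ length p"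
proof (induction p arbitrary: u)
  case (Cons e p)
  then have "(u, head \<Gamma> e) \<in> graph_step \<Gamma>" "(head \<Gamma> e, v) \<in> graph_step \<Gamma> ^^ length p"
    by (auto simp: graph_step_def pre_digraph.cas.simps)
  then show ?case by (metis length_Cons relpow_Suc_I2)
qed (simp add: pre_digraph.cas.simps)

text \<open>A walk is split at one of its vertices. For a geodesic the two lengths turn out to be
  the distances from that vertex to the ends.\<close>

lemma awalk_verts_relpow:
  assumes "pre_digraph.awalk \<Gamma> u p v" "x \<in> set (pre_digraph.awalk_verts \<Gamma> u p)"
  shows "\<exists>i j. i + j = length p \<and> (u, x) \<in> graph_step \<Gamma> ^^ i \<and> (x, v) \<in> graph_step \<Gamma> ^^ j"
proof -
  interpret pre_digraph \<Gamma> .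
  have "cas u p v \<Longrightarrow> set p \<subseteq> arcs \<Gamma> \<Longrightarrow> x \<in> set (awalk_verts u p) \<Longrightarrow> ?thesis"
  proof (induction p arbitrary: u)
    case (Cons e p)
    then have e: "(u, head \<Gamma> e) \<in> graph_step \<Gamma>"
      by (auto simp: graph_step_def)
    have p: "cas (head \<Gamma> e) p v" "set p \<subseteq> arcs \<Gamma>" using Cons.prems by auto
    show ?case
    proof (cases "x = u")
      case True
      have "(u, v) \<in> graph_step \<Gamma> ^^ length (e # p)"
        using Cons.prems(1,2) by (rule cas_relpow)
      then show ?thesis using True by (intro exI[of _ 0] exI[of _ "length (e # p)"]) simp
    next
      case False
      then have "x \<in> set (awalk_verts (head \<Gamma> e) p)" using Cons.prems by auto
      then obtain i j where "i + j = length p" "(head \<Gamma> e, x) \<in> graph_step \<Gamma> ^^ i"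
        "(x, v) \<in> graph_step \<Gamma> ^^ j"
        using Cons.IH[OF p] by blast
      then show ?thesis
        using e by (intro exI[of _ "Suc i"] exI[of _ j]) (auto intro: relpow_Suc_I2 simp del: relpow.simps(2))
    qed
  qed simp
  then show ?thesis using assms by (simp add: awalk_def)
qed

section \<open>The Cayley graph \<open>\<Gamma>\<close> and the subgraph \<open>\<Gamma>'\<close>
  that defines \<open>rel_dist\<close>\<close>

locale cayley = group G for G (structure) +
  fixes H X
  assumes H: "subgroup H G" and X: "X \<subseteq> carrier G" and gen: "generate G (X \<union> H) = carrier G"
begin

abbreviation \<Gamma> where "\<Gamma> \<equiv> cayley_graph G X H"
abbreviation \<Gamma>' where "\<Gamma>' \<equiv> \<Gamma>\<lparr>arcs := arcs \<Gamma> - H \<times> Sub ` H\<rparr>"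
abbreviation E where "E \<equiv> graph_step \<Gamma>"
abbreviation E' where "E' \<equiv> graph_step \<Gamma>'"

lemma letter_closed: "a \<in> letters X H \<Longrightarrow> letter_val G a \<in> carrier G"
  by (rule letter_val_closed[OF group_axioms H X])

lemma wf: "wf_digraph \<Gamma>" and wf': "wf_digraph \<Gamma>'"
  by (unfold_locales; auto simp: cayley_graph_def letter_closed)+

lemma E_iff: "(u, v) \<in> E \<longleftrightarrow> u \<in> carrier G \<and> (\<exists>a \<in> letters X H. v = u \<otimes> letter_val G a)"
  by (auto simp: graph_step_def cayley_graph_def)

lemma E'_iff:
  "(u, v) \<in> E' \<longleftrightarrow> u \<in> carrier G \<and> (\<exists>a \<in> letters X H. (u \<in> H \<longrightarrow> a \<notin> Sub ` H) \<and> v = u \<otimes> letter_val G a)"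
  by (auto simp: graph_step_def cayley_graph_def)

lemma E_I: "u \<in> carrier G \<Longrightarrow> a \<in> letters X H \<Longrightarrow> v = u \<otimes> letter_val G a \<Longrightarrow> (u, v) \<in> E"
  unfolding E_iff by blast

lemma E'_I: "u \<in> carrier G \<Longrightarrow> a \<in> letters X H \<Longrightarrow> (u \<in> H \<Longrightarrow> a \<notin> Sub ` H) \<Longrightarrow>
    v = u \<otimes> letter_val G a \<Longrightarrow> (u, v) \<in> E'"
  unfolding E'_iff by blast

lemma H_closed: "h \<in> H \<Longrightarrow> h \<in> carrier G"
  using subgroup.mem_carrier[OF H] .

lemma H_mult: "h \<in> H \<Longrightarrow> x \<in> carrier G \<Longrightarrow> h \<otimes> x \<in> H \<longleftrightarrow> x \<in> H"
  by (metis H H_closed inv_closed inv_solve_left subgroup.m_closed subgroup.m_inv_closed)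

lemma mult_H: "h \<in> H \<Longrightarrow> x \<in> carrier G \<Longrightarrow> x \<otimes> h \<in> H \<longleftrightarrow> x \<in> H"
  by (metis H H_closed inv_solve_right' subgroup.m_closed subgroup.m_inv_closed)

text \<open>Reading \<open>bar a\<close> traverses an edge labelled \<open>a\<close> backwards; this
  makes \<open>E\<close> and \<open>E'\<close> symmetric.\<close>

definition bar where "bar a = (case a of Gen s b \<Rightarrow> Gen s (\<not> b) | Sub h \<Rightarrow> Sub (inv h))"

lemma bar: "a \<in> letters X H \<Longrightarrow> bar a \<in> letters X H \<and> letter_val G (bar a) = inv (letter_val G a)"
  using X subgroup.m_inv_closed[OF H] by (auto simp: bar_def split: letter.split)

lemma bar_Sub: "bar a \<in> Sub ` H \<Longrightarrow> a \<in> letters X H \<Longrightarrow> a \<in> Sub ` H"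
  by (auto simp: bar_def split: letter.splits)

lemma E_closed: "(u, v) \<in> E \<Longrightarrow> u \<in> carrier G \<and> v \<in> carrier G"
  by (auto simp: E_iff letter_closed)

lemma E_sym:
  assumes "(u, v) \<in> E"
  shows "(v, u) \<in> E"
proof -
  obtain a where a: "u \<in> carrier G" "a \<in> letters X H" "v = u \<otimes> letter_val G a"
    using assms by (auto simp: E_iff)
  then have "u = v \<otimes> letter_val G (bar a)"
    using letter_closed[of a] bar by (simp add: m_assoc)
  then show ?thesis
    using a letter_closed[of a] bar[of a] by (intro E_I[of v "bar a"]) (simp_all only: m_closed simp_thms)
qed

lemma E'_sym:
  assumes "(u, v) \<in> E'"
  shows "(v, u) \<in> E'"
proof -
  obtain a where a: "u \<in> carrier G" "a \<in> letters X H" "u \<in> H \<longrightarrow> a \<notin> Sub ` H" "v = u \<otimes> letter_val G a"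
    using assms by (auto simp: E'_iff)
  have c: "letter_val G a \<in> carrier G" using a letter_closed by blast
  \<comment> \<open>An edge labelled by a letter of \<open>H\<close> has both or none of its ends in
    \<open>H\<close>, so removed edges come in mutually inverse pairs.\<close>
  have "v \<notin> H" if "bar a \<in> Sub ` H"
  proof -
    have "a \<in> Sub ` H" using that a bar_Sub by blast
    then have "letter_val G a \<in> H" "u \<notin> H" using a by auto
    then show ?thesis
      using a c mult_H by blast
  qed
  moreover have "u = v \<otimes> letter_val G (bar a)"
    using a c bar by (simp add: m_assoc)
  moreover have "v \<in> carrier G" "bar a \<in> letters X H"
    using a(1,2,4) c bar[of a] by blast+
  ultimately show ?thesis
    by (intro E'_I[of v "bar a"]) blast+
qed

text \<open>Every removed edge has both ends in \<open>H\<close>, because \<open>H\<close> is closed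
  under multiplication.\<close>

lemma E_E':
  assumes "(u, v) \<in> E" "u \<notin> H \<or> v \<notin> H"
  shows "(u, v) \<in> E'"
proof -
  obtain a where a: "u \<in> carrier G" "a \<in> letters X H" "v = u \<otimes> letter_val G a"
    using assms(1) by (auto simp: E_iff)
  have "a \<notin> Sub ` H" if "u \<in> H"
  proof
    assume "a \<in> Sub ` H"
    then have "letter_val G a \<in> H" by auto
    then have "v \<in> H" using a(3) that subgroup.m_closed[OF H] by blast
    then show False using that assms(2) by blast
  qed
  then show ?thesis using a by (intro E'_I)
qed

lemma E'_E: "(u, v) \<in> E' \<Longrightarrow> (u, v) \<in> E"
  unfolding E_iff E'_iff by blast

lemma H_edge: "u \<in> H \<Longrightarrow> v \<in> H \<Longrightarrow> (u, v) \<in> E"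
  using H_closed by (intro E_I[of u "Sub (inv u \<otimes> v)"])
    (simp_all add: subgroup.m_closed[OF H] subgroup.m_inv_closed[OF H] flip: m_assoc)

text \<open>Left multiplication by \<open>h \<in> H\<close> keeps labels and preserves
  \<open>H\<close>, hence also the set of removed edges. Relative distances within \<open>H\<close>
  can therefore be measured from the identity.\<close>

lemma E'_translate:
  assumes "h \<in> H" "(u, v) \<in> E'"
  shows "(h \<otimes> u, h \<otimes> v) \<in> E'"
proof -
  obtain a where a: "u \<in> carrier G" "a \<in> letters X H" "u \<in> H \<Longrightarrow> a \<notin> Sub ` H"
    "v = u \<otimes> letter_val G a"
    using assms(2) by (auto simp: E'_iff)
  then show ?thesis
    using assms(1) H_closed H_mult letter_closed[of a] by (intro E'_I[of _ a]) (auto simp: m_assoc)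
qed

lemma E'_pow_translate: "h \<in> H \<Longrightarrow> (u, v) \<in> E' ^^ n \<Longrightarrow> (h \<otimes> u, h \<otimes> v) \<in> E' ^^ n"
  by (induction n arbitrary: v) (auto intro: E'_translate)

lemma E_pow_closed: "(u, v) \<in> E ^^ n \<Longrightarrow> u \<in> carrier G \<Longrightarrow> v \<in> carrier G"
  by (induction n arbitrary: v) (auto dest: E_closed)

lemma connected:
  assumes "u \<in> carrier G" "v \<in> carrier G"
  shows "\<exists>n. (u, v) \<in> E ^^ n"
proof -
  \<comment> \<open>The starting point is kept arbitrary: for a product, the path for the second
    factor starts where the path for the first one ends.\<close>
  have *: "\<forall>u \<in> carrier G. \<exists>n. (u, u \<otimes> z) \<in> E ^^ n" if "z \<in> generate G (X \<union> H)" for z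
    using that
  proof (induction rule: generate.induct)
    case one
    show ?case by (auto intro!: exI[of _ 0])
  next
    case (incl h)
    then have "\<exists>a \<in> letters X H. letter_val G a = h"
      by (auto intro: bexI[of _ "Gen h True"] bexI[of _ "Sub h"])
    then show ?case
      by (auto intro!: exI[of _ 1] simp: E_iff)
  next
    case (inv h)
    then obtain a where "a \<in> letters X H" "letter_val G a = inv h"
      using subgroup.m_inv_closed[OF H, of h] that[of "Gen h False"] that[of "Sub (inv h)"] by auto
    then have "(u, u \<otimes> inv h) \<in> E ^^ 1" if "u \<in> carrier G" for u
      using that by (auto intro: E_I)
    then show ?case by blast
  next
    case (eng x y)
    show ?case
    proof
      fix u assume u: "u \<in> carrier G"
      have c: "x \<in> carrier G" "y \<in> carrier G" using eng gen by auto
      obtain m n where "(u, u \<otimes> x) \<in> E ^^ m" "(u \<otimes> x, u \<otimes> x \<otimes> y) \<in> E ^^ n"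
        using eng u c by (meson m_closed)
      then have "(u, u \<otimes> (x \<otimes> y)) \<in> E ^^ (m + n)"
        using relpow_trans u c by (metis m_assoc)
      then show "\<exists>n. (u, u \<otimes> (x \<otimes> y)) \<in> E ^^ n" ..
    qed
  qed
  have "inv u \<otimes> v \<in> generate G (X \<union> H)" using assms gen by simp
  from bspec[OF *[OF this] assms(1)] show ?thesis
    using assms by (simp flip: m_assoc)
qed

section \<open>The word metric, geodesics and slim triangles\<close>

definition d where "d u v = (LEAST n. (u, v) \<in> E ^^ n)"

lemma d_pow: "u \<in> carrier G \<Longrightarrow> v \<in> carrier G \<Longrightarrow> (u, v) \<in> E ^^ d u v"
  unfolding d_def by (rule LeastI_ex) (rule connected)

lemma d_le: "(u, v) \<in> E ^^ n \<Longrightarrow> d u v \<le> n"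
  unfolding d_def by (rule Least_le)

lemma d_0: "u \<in> carrier G \<Longrightarrow> v \<in> carrier G \<Longrightarrow> d u v = 0 \<longleftrightarrow> u = v"
  using d_pow[of u v] d_le[of u v 0] by auto

lemma d_sym: "u \<in> carrier G \<Longrightarrow> v \<in> carrier G \<Longrightarrow> d u v = d v u"
  by (metis E_sym antisym d_le d_pow relpow_sym)

lemma d_triangle: "u \<in> carrier G \<Longrightarrow> v \<in> carrier G \<Longrightarrow> w \<in> carrier G \<Longrightarrow> d u w \<le> d u v + d v w"
  by (rule d_le, rule relpow_trans[of _ v]) (auto intro: d_pow)

lemma d_edge: "(u, v) \<in> E \<Longrightarrow> d u v \<le> 1"
  by (rule d_le) simp

lemma graph_dist_le: "u \<in> carrier G \<Longrightarrow> v \<in> carrier G \<Longrightarrow> graph_dist \<Gamma> u v \<le> enat n \<longleftrightarrow> d u v \<le> n"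
  using graph_dist_le_iff[OF wf, of u v n] d_pow[of u v] d_le[of u v]
  by (auto simp: cayley_graph_def intro: order_trans)

lemma graph_dist_eq: "u \<in> carrier G \<Longrightarrow> v \<in> carrier G \<Longrightarrow> graph_dist \<Gamma> u v = enat (d u v)"
  using graph_dist_le[of u v "d u v"] graph_dist_le[of u v]
  by (metis antisym enat_ile enat_ord_simps(1) order_refl)

text \<open>This says that \<open>x\<close> lies on some geodesic from \<open>u\<close> to
  \<open>v\<close>, without mentioning a path.\<close>

definition between where
  "between u x v \<longleftrightarrow> u \<in> carrier G \<and> x \<in> carrier G \<and> v \<in> carrier G \<and> d u x + d x v = d u v"

lemma between_sym: "between u x v \<Longrightarrow> between v x u"
  unfolding between_def using d_sym by (metis add.commute)

lemma point_at_distance: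
  assumes "u \<in> carrier G" "v \<in> carrier G" "k \<le> d u v"
  obtains x where "between u x v" "d u x = k"
proof -
  have "(u, v) \<in> E ^^ (k + (d u v - k))" using d_pow assms by simp
  then obtain x where x: "(u, x) \<in> E ^^ k" "(x, v) \<in> E ^^ (d u v - k)"
    unfolding relpow_add by blast
  then have "x \<in> carrier G" "d u x \<le> k" "d x v \<le> d u v - k"
    using assms E_pow_closed d_le by auto
  then show thesis
    using that[of x] d_triangle[of u x v] assms by (auto simp: between_def)
qed

lemma geodesic_through:
  assumes "between u x v"
  obtains p where "geodesic \<Gamma> u p v" "x \<in> set (pre_digraph.awalk_verts \<Gamma> u p)"
proof -
  interpret wf_digraph \<Gamma> by (rule wf)
  have c: "u \<in> carrier G" "x \<in> carrier G" "v \<in> carrier G" "d u x + d x v = d u v"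
    using assms by (auto simp: between_def)
  have verts: "verts \<Gamma> = carrier G" by (simp add: cayley_graph_def)
  obtain p q where p: "awalk u p x" "length p = d u x" and q: "awalk x q v" "length q = d x v"
    using awalk_relpow[OF wf, of u x "d u x"] awalk_relpow[OF wf, of x v "d x v"] c d_pow verts by auto
  have "awalk u (p @ q) v" using p q by simp
  moreover have "x \<in> set (awalk_verts u (p @ q))"
    unfolding awalk_verts_append[OF \<open>awalk u (p @ q) v\<close>]
    using p(1) last_in_set[OF awalk_verts_non_Nil, of u p] by (simp del: last_in_set)
  ultimately show thesis
    using that[of "p @ q"] c p q by (simp add: geodesic_def graph_dist_eq)
qed

lemma geodesic_between:
  assumes "geodesic \<Gamma> u p v" "x \<in> set (pre_digraph.awalk_verts \<Gamma> u p)"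
  shows "between u x v"
proof -
  interpret wf_digraph \<Gamma> by (rule wf)
  have verts: "verts \<Gamma> = carrier G" by (simp add: cayley_graph_def)
  have w: "awalk u p v" "enat (length p) = graph_dist \<Gamma> u v"
    using assms by (auto simp: geodesic_def)
  then have c: "u \<in> carrier G" "v \<in> carrier G" using verts by auto
  obtain i j where ij: "i + j = length p" "(u, x) \<in> E ^^ i" "(x, v) \<in> E ^^ j"
    using awalk_verts_relpow[OF w(1) assms(2)] by blast
  have x: "x \<in> carrier G" using ij c E_pow_closed by blast
  have "d u x \<le> i" "d x v \<le> j" "d u v = i + j"
    using ij d_le w c graph_dist_eq by auto
  then show ?thesis
    using c x d_triangle[of u x v] by (simp add: between_def)
qed

text \<open>Unlike in \<open>hyperbolic_graph\<close>, the sides of the triangle are not fixed: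
  \<open>x\<close> and \<open>y\<close> only lie on some geodesics with the given ends.\<close>

definition slim where
  "slim \<delta> \<longleftrightarrow> (\<forall>u x v w. between u x v \<and> w \<in> carrier G \<longrightarrow>
     (\<exists>y. (between v y w \<or> between w y u) \<and> d x y \<le> \<delta>))"

lemma hyperbolic_slim:
  assumes "hyperbolic_graph \<Gamma>"
  obtains \<delta> where "slim \<delta>"
proof -
  obtain \<delta> :: nat where \<delta>: "\<forall>u v w p q r. geodesic \<Gamma> u p v \<and> geodesic \<Gamma> v q w \<and> geodesic \<Gamma> w r u \<longrightarrow>
     (\<forall>x \<in> set (pre_digraph.awalk_verts \<Gamma> u p).
        \<exists>y \<in> set (pre_digraph.awalk_verts \<Gamma> v q) \<union> set (pre_digraph.awalk_verts \<Gamma> w r).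
          graph_dist \<Gamma> x y \<le> enat \<delta>)"
    using assms unfolding hyperbolic_graph_def by blast
  have "slim \<delta>"
    unfolding slim_def
  proof (intro allI impI, elim conjE)
    fix u x v w assume b: "between u x v" "w \<in> carrier G"
    then have c: "u \<in> carrier G" "x \<in> carrier G" "v \<in> carrier G" by (auto simp: between_def)
    \<comment> \<open>With this, \<open>geodesic_through\<close> also supplies the two sides that
      need not contain a prescribed point.\<close>
    have triv: "between s s t" if "s \<in> carrier G" "t \<in> carrier G" for s t
      using that d_0[of s s] by (simp add: between_def)
    obtain p where p: "geodesic \<Gamma> u p v" "x \<in> set (pre_digraph.awalk_verts \<Gamma> u p)"
      using geodesic_through b by blast
    obtain q where q: "geodesic \<Gamma> v q w" using geodesic_through[OF triv[OF c(3) b(2)]] by blast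
    obtain r where r: "geodesic \<Gamma> w r u" using geodesic_through[OF triv[OF b(2) c(1)]] by blast
    obtain y where y: "y \<in> set (pre_digraph.awalk_verts \<Gamma> v q) \<union> set (pre_digraph.awalk_verts \<Gamma> w r)"
      "graph_dist \<Gamma> x y \<le> enat \<delta>"
      using \<delta>[rule_format, OF conjI[OF p(1) conjI[OF q r]] p(2)] by (rule bexE)
    then have "between v y w \<or> between w y u"
      using geodesic_between[OF q, of y] geodesic_between[OF r, of y] by (auto simp only: Un_iff)
    then show "\<exists>y. (between v y w \<or> between w y u) \<and> d x y \<le> \<delta>"
      using y(2) graph_dist_le c by (auto simp: between_def)
  qed
  then show thesis using that by blast
qed

section \<open>Distance to \<open>H\<close> and nearest points\<close>

definition dH where "dH x = (LEAST n. \<exists>h \<in> H. d x h = n)"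
definition proj where "proj x = (SOME h. h \<in> H \<and> d x h = dH x)"

lemma proj: "proj x \<in> H" "d x (proj x) = dH x"
proof -
  have "\<exists>h \<in> H. d x h = dH x"
    unfolding dH_def by (rule LeastI[of _ "d x \<one>"]) (use subgroup.one_closed[OF H] in blast)
  then have "\<exists>h. h \<in> H \<and> d x h = dH x" by blast
  from someI_ex[OF this] show "proj x \<in> H" "d x (proj x) = dH x"
    unfolding proj_def by auto
qed

lemma dH_le: "h \<in> H \<Longrightarrow> dH x \<le> d x h"
  unfolding dH_def by (rule Least_le) blast

lemma dH_lipschitz: "x \<in> carrier G \<Longrightarrow> y \<in> carrier G \<Longrightarrow> dH x \<le> d x y + dH y"
  using dH_le[OF proj(1), of x y] d_triangle[of x y "proj y"] proj[of y] H_closed by fastforce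

lemma dH_pos: "x \<in> carrier G \<Longrightarrow> dH x > 0 \<Longrightarrow> x \<notin> H"
  using dH_le[of x x] d_0[of x x] by auto

lemma proj_H: "h \<in> H \<Longrightarrow> proj h = h"
  using dH_le[of h h] d_0[of h h] d_0[of h "proj h"] proj[of h] H_closed by auto

text \<open>A shortest path that is no longer than the distance of its start from \<open>H\<close>
  can meet \<open>H\<close> at most in its last vertex. All its edges start outside
  \<open>H\<close>, so none of them is removed.\<close>

lemma avoiding_path:
  "x \<in> carrier G \<Longrightarrow> y \<in> carrier G \<Longrightarrow> d x y = n \<Longrightarrow> dH x > n \<or> (dH x = n \<and> y \<in> H) \<Longrightarrow> (x, y) \<in> E' ^^ n"
proof (induction n arbitrary: x)
  case 0
  then show ?case using d_0 by simp
next
  case (Suc n)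
  obtain z where z: "between x z y" "d x z = 1"
    using point_at_distance[of x y 1] Suc.prems by auto
  then have c: "z \<in> carrier G" "d z y = n"
    using Suc.prems by (auto simp: between_def)
  \<comment> \<open>One step lowers the distance to \<open>H\<close> by at most one, so
    \<open>z\<close> inherits the assumption for the remaining \<open>n\<close> steps; if
    \<open>y \<in> H\<close>, the distance \<open>n\<close> from \<open>z\<close> to
    \<open>y\<close> is also an upper bound.\<close>
  have "dH x \<le> Suc (dH z)" "dH z \<le> n" if "y \<in> H"
    using dH_lipschitz[of x z] z(2) Suc.prems c dH_le[OF that, of z] by auto
  moreover have "dH x \<le> Suc (dH z)"
    using dH_lipschitz[of x z] z(2) Suc.prems c by auto
  ultimately have "(z, y) \<in> E' ^^ n"
    using Suc.IH[of z] Suc.prems c by linarith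
  moreover have "(x, z) \<in> E'"
    using z(2) d_pow[of x z] c Suc.prems dH_pos[of x] by (intro E_E') auto
  ultimately show ?case by (rule relpow_Suc_I2[rotated])
qed

lemma path_to_proj: "x \<in> carrier G \<Longrightarrow> (x, proj x) \<in> E' ^^ dH x"
  using avoiding_path[of x "proj x" "dH x"] proj H_closed by simp

text \<open>Near \<open>H\<close>, the path \<open>proj g\<close>, \<open>g\<close>,
  \<open>g'\<close>, \<open>proj g'\<close> is short enough, of length at most
  \<open>8 * \<delta> + 6\<close>. Far from \<open>H\<close>, the quadrilateral with these four
  corners is thin: a point near the bottom of one vertical side is close to the other vertical side,
  and a shortcut through these points avoids \<open>H\<close> except at its ends; its length is at
  most \<open>8 * \<delta> + 2\<close>.\<close>

lemma proj_edge:
  assumes "slim \<delta>" and e: "(g, g') \<in> E'"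
  shows "\<exists>n \<le> 20 * \<delta> + 20. (proj g, proj g') \<in> E' ^^ n"
proof -
  have c: "g \<in> carrier G" "g' \<in> carrier G" and dgg: "d g g' \<le> 1"
    using e E'_E E_closed d_edge by blast+
  \<comment> \<open>The height at which the shortcut leaves the first side. It exceeds
    \<open>2 * \<delta>\<close>, the bound on the length of the crossing, so the crossing cannot
    reach \<open>H\<close>.\<close>
  define T where "T = 2 * \<delta> + 1"
  have lip: "dH g' \<le> dH g + 1" using dH_lipschitz[of g' g] c dgg d_sym by simp
  have pc: "proj x \<in> carrier G" for x using proj H_closed by blast
  show ?thesis
  proof (cases "dH g \<le> T + 2 * \<delta> + 1")
    case True
    have "(proj g, g) \<in> E' ^^ dH g"
      using path_to_proj[OF c(1)] relpow_sym[of E'] E'_sym by blast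
    then have "(proj g, proj g') \<in> E' ^^ (dH g + (1 + dH g'))"
      using e path_to_proj[OF c(2)] by (intro relpow_trans[of _ g] relpow_trans[of _ g']) auto
    then show ?thesis
      using True lip by (intro exI[of _ "dH g + (1 + dH g')"]) (simp add: T_def)
  next
    case False
    obtain x where x: "between (proj g) x g" "d (proj g) x = T"
      using point_at_distance[of "proj g" g T] False c pc proj(2)[of g] d_sym[of g "proj g"] by auto
    then have xc: "x \<in> carrier G" by (simp add: between_def)
    have dxg: "d x g = dH g - T"
      using x proj(2)[of g] d_sym[of g "proj g"] c pc by (auto simp: between_def)
    have dx: "d x (proj g) = T" using x(2) d_sym xc pc by metis
    have dHx: "dH x = T"
      using dH_le[OF proj(1)[of g], of x] dx dH_lipschitz[of g x] dxg d_sym[of g x] c xc False by simp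
    obtain y where y: "between g y (proj g') \<or> between (proj g') y (proj g)" "d x y \<le> \<delta>"
      using assms(1) x(1) pc unfolding slim_def by blast
    \<comment> \<open>Any two elements of \<open>H\<close> are adjacent or equal in
      \<open>\<Gamma>\<close>, so the bottom side contains only points of \<open>H\<close>, which
      are too far from \<open>x\<close>.\<close>
    have "\<not> between (proj g') y (proj g)"
    proof
      assume b: "between (proj g') y (proj g)"
      then have yc: "y \<in> carrier G" by (simp add: between_def)
      have "d (proj g') (proj g) \<le> 1" using d_edge[OF H_edge[OF proj(1) proj(1)]] .
      then have "y = proj g' \<or> y = proj g"
        using b d_0[of "proj g'" y] d_0[of y "proj g"] pc by (auto simp: between_def)
      then have "y \<in> H" using proj by auto
      then show False using dH_le[of y x] dHx y(2) T_def by simp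
    qed
    then have y1: "between g y (proj g')" using y by blast
    then have yc: "y \<in> carrier G" by (simp add: between_def)
    obtain z where z: "between (proj g') z g' \<or> between g' z g" "d y z \<le> \<delta>"
      using assms(1) y1 c unfolding slim_def by blast
    then have zc: "z \<in> carrier G" by (auto simp: between_def)
    have dxz: "d x z \<le> 2 * \<delta>"
      using d_triangle[OF xc yc zc] y(2) z(2) by simp
    \<comment> \<open>The top side has length at most one and lies too high: in this case
      \<open>d x g\<close> exceeds \<open>2 * \<delta> + 1\<close>.\<close>
    have "\<not> between g' z g"
    proof
      assume b: "between g' z g"
      then have "d z g \<le> 1" using dgg d_sym[of g g'] c by (auto simp: between_def)
      then have "d x g \<le> 2 * \<delta> + 1" using d_triangle[OF xc zc c(1)] dxz by simp
      then show False using dxg False by simp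
    qed
    then have z1: "between (proj g') z g'" using z by blast
    \<comment> \<open>A point on a geodesic from \<open>g'\<close> to its nearest point has the same
      nearest point.\<close>
    have "dH g' \<le> d g' z + dH z" by (rule dH_lipschitz[OF c(2) zc])
    moreover have "d g' z + d z (proj g') = dH g'"
      using between_sym[OF z1] proj(2)[of g'] by (simp add: between_def)
    ultimately have dz: "d z (proj g') = dH z"
      using dH_le[OF proj(1)[of g'], of z] by linarith
    have dHz: "dH z \<le> T + 2 * \<delta>"
      using dH_lipschitz[OF zc xc] dxz d_sym[OF xc zc] dHx by simp
    have "(x, proj g) \<in> E' ^^ T"
      using avoiding_path[of x "proj g" T] dx dHx xc pc proj(1) by blast
    then have "(proj g, x) \<in> E' ^^ T" using relpow_sym[of E'] E'_sym by blast
    moreover have "(x, z) \<in> E' ^^ d x z"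
      using avoiding_path[of x z "d x z"] xc zc dHx dxz T_def by auto
    moreover have "(z, proj g') \<in> E' ^^ dH z"
      using avoiding_path[of z "proj g'" "dH z"] dz zc pc proj(1) by blast
    ultimately have "(proj g, proj g') \<in> E' ^^ (T + (d x z + dH z))"
      by (intro relpow_trans)
    then show ?thesis
      using dHz dxz by (intro exI[of _ "T + (d x z + dH z)"]) (simp add: T_def)
  qed
qed

lemma rel_dist_le: "u \<in> H \<Longrightarrow> rel_dist G X H u v \<le> enat n \<longleftrightarrow> (\<exists>k \<le> n. (u, v) \<in> E' ^^ k)"
  using graph_dist_le_iff[OF wf', of u v n] H_closed by (simp add: rel_dist_def cayley_graph_def)

end

section \<open>Finite generation and relative presentations\<close>

text \<open>Along a path from \<open>\<one>\<close> to \<open>h\<close> with labels in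
  \<open>Z\<close>, the projections move from \<open>\<one>\<close> to \<open>h\<close>, and each
  step multiplies by an element of the subgroup generated by the finite set
  \<open>Y\<close>.\<close>

lemma (in cayley) finitely_generated_subgroup:
  assumes hyp: "hyperbolic_graph \<Gamma>" and fin: "\<And>n. finite {k \<in> H. rel_dist G X H \<one> k \<le> enat n}"
    and Z: "finite Z" "Z \<subseteq> X \<union> H" "generate G Z = carrier G"
  obtains Y where "finite Y" "Y \<subseteq> H" "generate G Y = H"
proof -
  obtain \<delta> where \<delta>: "slim \<delta>" using hyperbolic_slim[OF hyp] .
  \<comment> \<open>The ball handles the edges of \<open>\<Gamma>'\<close> through
    \<open>proj_edge\<close>; \<open>Z \<inter> H\<close> handles the removed edges, where
    projection does nothing.\<close>
  define Y where "Y = {k \<in> H. rel_dist G X H \<one> k \<le> enat (20 * \<delta> + 20)} \<union> (Z \<inter> H)"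
  have Y: "finite Y" "Y \<subseteq> H" using fin Z(1) by (auto simp: Y_def)
  have Yc: "Y \<subseteq> carrier G" using Y(2) H_closed by blast
  have ZG: "Z \<subseteq> carrier G" using Z(2) X H_closed by blast
  have pc: "proj g \<in> carrier G" for g using proj H_closed by blast
  have step: "inv (proj g) \<otimes> proj (g \<otimes> z) \<in> generate G Y" if g: "g \<in> carrier G" and z: "z \<in> Z" for g z
  proof (cases "g \<in> H \<and> z \<in> H")
    case True
    then have "inv (proj g) \<otimes> proj (g \<otimes> z) = z"
      using proj_H subgroup.m_closed[OF H] H_closed by (simp flip: m_assoc)
    then show ?thesis using True z by (auto simp: Y_def intro: generate.incl)
  next
    case False
    have zG: "z \<in> carrier G" using z ZG by blast
    have "(g, g \<otimes> z) \<in> E'"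
    proof (cases "z \<in> H")
      case True
      then have "g \<notin> H" using False by blast
      then show ?thesis using True g by (intro E_E' E_I[of g "Sub z"]) auto
    next
      case False
      then have "z \<in> X" using z Z(2) by blast
      then show ?thesis using g by (intro E'_I[of g "Gen z True"]) auto
    qed
    then obtain n where n: "n \<le> 20 * \<delta> + 20" "(proj g, proj (g \<otimes> z)) \<in> E' ^^ n"
      using proj_edge[OF \<delta>] by blast
    have iH: "inv (proj g) \<in> H" using subgroup.m_inv_closed[OF H proj(1)] .
    \<comment> \<open>Translation by the inverse of \<open>proj g\<close> brings the path to the
      identity, about which the ball is taken.\<close>
    have "(\<one>, inv (proj g) \<otimes> proj (g \<otimes> z)) \<in> E' ^^ n"
      using E'_pow_translate[OF iH n(2)] pc by simp
    moreover have "inv (proj g) \<otimes> proj (g \<otimes> z) \<in> H"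
      using subgroup.m_closed[OF H iH proj(1)] .
    ultimately show ?thesis
      using n(1) rel_dist_le[OF subgroup.one_closed[OF H]]
      by (auto simp: Y_def intro!: generate.incl)
  qed
  \<comment> \<open>Increments of the projection telescope along a path.\<close>
  have diff: "inv (proj g) \<otimes> proj k =
      (inv (proj g) \<otimes> proj l) \<otimes> (inv (proj l) \<otimes> proj k)" for g l k
    using pc by (simp add: m_assoc) (simp flip: m_assoc)
  have "\<forall>g \<in> carrier G. inv (proj g) \<otimes> proj (g \<otimes> z) \<in> generate G Y" if "z \<in> generate G Z" for z
    using that
  proof (induction rule: generate.induct)
    case one
    show ?case using pc by (auto intro: generate.one)
  next
    case (incl z)
    then show ?case using step by blast
  next
    case (inv z)
    show ?case
    proof
      fix g assume g: "g \<in> carrier G"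
      have z: "z \<in> carrier G" using inv ZG by blast
      \<comment> \<open>An inverse generator is a step along \<open>z\<close> taken backwards, from
        its end \<open>g\<close>.\<close>
      have "inv (proj (g \<otimes> inv z)) \<otimes> proj g \<in> generate G Y"
        using step[of "g \<otimes> inv z" z] g z inv by (simp add: m_assoc)
      from generate_m_inv_closed[OF Yc this]
      show "inv (proj g) \<otimes> proj (g \<otimes> inv z) \<in> generate G Y"
        using pc by (simp add: inv_mult_group)
    qed
  next
    case (eng y z)
    have c: "y \<in> carrier G" "z \<in> carrier G" using eng Z(3) by auto
    show ?case
    proof
      fix g assume g: "g \<in> carrier G"
      have "inv (proj (g \<otimes> y)) \<otimes> proj (g \<otimes> (y \<otimes> z)) \<in> generate G Y"
        using bspec[OF eng(4), of "g \<otimes> y"] g c by (simp add: m_assoc)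
      then show "inv (proj g) \<otimes> proj (g \<otimes> (y \<otimes> z)) \<in> generate G Y"
        using eng(3) g diff[of g "g \<otimes> (y \<otimes> z)" "g \<otimes> y"] by (auto intro: generate.eng)
    qed
  qed
  note all = bspec[OF this one_closed]
  have "h \<in> generate G Y" if "h \<in> H" for h
    using all[of h] that Z(3) H_closed[OF that] proj_H[OF that] proj_H[OF subgroup.one_closed[OF H]] by simp
  then have "H \<subseteq> generate G Y" by blast
  then show thesis
    using that Y generate_subgroup_incl[OF Y(2) H] by blast
qed

section \<open>Computations in the relative free product\<close>

context
  fixes G (structure) and H S
  assumes G: "group G" and H: "subgroup H G" and S: "S \<subseteq> carrier G"
begin

interpretation G: group G by (rule G)
interpretation F: group "rel_free G H S" by (rule rel_free_group[OF G H])

private abbreviation F where "F \<equiv> rel_free G H S"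
private abbreviation cl where "cl \<equiv> rel_class G H S"

lemma rel_class_closed: "w \<in> lists (letters S H) \<Longrightarrow> cl w \<in> carrier F"
  using carrier_rel_free[OF G H S] by blast

lemma rel_class_Nil: "cl [] = \<one>\<^bsub>F\<^esub>"
  by (simp add: rel_class_def free_prod_class_def rel_free_def free_prod_def one_word_monoid)

lemma rel_class_eqI:
  assumes "(u, v) \<in> free_prod_rels S (G\<lparr>carrier := H\<rparr>)"
    "u \<in> lists (letters S H)" "v \<in> lists (letters S H)"
  shows "cl u = cl v"
  using word_cong_rel[OF assms] assms(2,3)
  by (simp add: rel_class_def free_prod_class_def word_class_eq_iff)

lemma rel_class_Cons: "a \<in> letters S H \<Longrightarrow> w \<in> lists (letters S H) \<Longrightarrow> cl (a # w) = cl [a] \<otimes>\<^bsub>F\<^esub> cl w"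
  using rel_class_append[OF G H S, of "[a]" w] by simp

lemma rel_class_Sub_mult:
  assumes "h \<in> H" "k \<in> H"
  shows "cl [Sub (h \<otimes> k)] = cl [Sub h] \<otimes>\<^bsub>F\<^esub> cl [Sub k]"
proof -
  have "cl [Sub h, Sub k] = cl [Sub (h \<otimes> k)]"
    using free_prod_rels_Sub[of h "G\<lparr>carrier := H\<rparr>" k S] assms subgroup.m_closed[OF H]
    by (intro rel_class_eqI) auto
  then show ?thesis using assms rel_class_Cons[of "Sub h" "[Sub k]"] by simp
qed

lemma rel_class_Sub_one: "cl [Sub \<one>] = \<one>\<^bsub>F\<^esub>"
  using free_prod_rels_one[of "G\<lparr>carrier := H\<rparr>" S] subgroup.one_closed[OF H]
  by (subst rel_class_Nil[symmetric], intro rel_class_eqI) auto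

lemma rel_class_Sub_inv:
  assumes "h \<in> H"
  shows "cl [Sub (inv h)] = inv\<^bsub>F\<^esub> cl [Sub h]"
proof (rule F.inv_equality[symmetric])
  have i: "inv h \<in> H" using assms subgroup.m_inv_closed[OF H] by blast
  show "cl [Sub (inv h)] \<otimes>\<^bsub>F\<^esub> cl [Sub h] = \<one>\<^bsub>F\<^esub>"
    using rel_class_Sub_mult[OF i assms] rel_class_Sub_one subgroup.mem_carrier[OF H assms] by simp
  show "cl [Sub h] \<in> carrier F" "cl [Sub (inv h)] \<in> carrier F"
    using assms i by (simp_all add: rel_class_closed)
qed

lemma rel_class_Gen_inv:
  assumes "s \<in> S"
  shows "cl [Gen s False] = inv\<^bsub>F\<^esub> cl [Gen s True]"
proof (rule F.inv_equality[symmetric])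
  have "([Gen s False, Gen s True], []) \<in> free_prod_rels S (G\<lparr>carrier := H\<rparr>)"
    using free_prod_rels_Gen[OF assms, of True] by simp
  then have "cl [Gen s False, Gen s True] = \<one>\<^bsub>F\<^esub>"
    using assms by (subst rel_class_Nil[symmetric], intro rel_class_eqI) auto
  then show "cl [Gen s False] \<otimes>\<^bsub>F\<^esub> cl [Gen s True] = \<one>\<^bsub>F\<^esub>"
    using assms rel_class_Cons[of "Gen s False" "[Gen s True]"] by simp
qed (use assms in \<open>simp_all add: rel_class_closed\<close>)

text \<open>The letters \<open>Sub h\<close> multiply in \<open>F\<close> as their values do in
  \<open>H\<close>, so it is enough to treat generators of \<open>H\<close>. A possibly infinite
  alphabet is thereby reduced to the letters from \<open>S\<close> and \<open>Y\<close>.\<close>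

lemma subgroup_rel_free_eq:
  assumes I: "subgroup I F" and Y: "Y \<subseteq> H" "generate G Y = H"
    and Gen: "\<And>s. s \<in> S \<Longrightarrow> cl [Gen s True] \<in> I" and Sub: "\<And>y. y \<in> Y \<Longrightarrow> cl [Sub y] \<in> I"
  shows "I = carrier F"
proof -
  interpret I: subgroup I F by (rule I)
  have SubH: "cl [Sub h] \<in> I" if "h \<in> generate G Y" for h
    using that
  proof (induction rule: generate.induct)
    case one
    show ?case by (simp add: rel_class_Sub_one)
  next
    case (inv y)
    then show ?case using Y(1) Sub by (simp add: rel_class_Sub_inv subsetD)
  next
    case (eng x y)
    then show ?case using Y(2) by (simp add: rel_class_Sub_mult)
  qed (rule Sub)
  have letter: "cl [a] \<in> I" if a: "a \<in> letters S H" for a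
  proof (cases a)
    case (Gen s b)
    then show ?thesis
      using a assms(4)[of s] by (cases b) (simp_all add: rel_class_Gen_inv)
  next
    case (Sub h)
    then show ?thesis using a SubH Y(2) by simp
  qed
  have "cl w \<in> I" if "w \<in> lists (letters S H)" for w
    using that
  proof (induction w)
    case (Cons a w)
    then show ?case using letter rel_class_Cons[of a w] by auto
  qed (simp add: rel_class_Nil)
  then show ?thesis
    using I.subset carrier_rel_free[OF G H S] by auto
qed

lemma rel_hom_group_hom: "group_hom F G (rel_hom G)"
  by unfold_locales (rule rel_hom_hom[OF G H S])

lemma rel_hom_surj:
  assumes "generate G (S \<union> H) = carrier G"
  shows "rel_hom G ` carrier F = carrier G"
proof
  interpret h: group_hom F G "rel_hom G" by (rule rel_hom_group_hom)
  show "rel_hom G ` carrier F \<subseteq> carrier G" by auto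
  have "x \<in> rel_hom G ` carrier F" if "x \<in> S \<union> H" for x
  proof -
    have "\<exists>a \<in> letters S H. letter_val G a = x"
      using that by (auto intro: bexI[of _ "Gen x True"] bexI[of _ "Sub x"])
    then obtain a where a: "a \<in> letters S H" "letter_val G a = x" by blast
    then have "rel_hom G (cl [a]) = x"
      using rel_hom_class[OF G H S, of "[a]"] that S subgroup.mem_carrier[OF H]
      by (auto simp: word_val_def)
    then show ?thesis using rel_class_closed[of "[a]"] a(1) by auto
  qed
  then show "carrier G \<subseteq> rel_hom G ` carrier F"
    using G.generate_subgroup_incl[OF _ h.img_is_subgroup] assms by blast
qed

text \<open>The generators of a finite presentation of \<open>G\<close> are lifted to \<open>F\<close>; besides the lifted
  relators it then suffices to express the letters from \<open>S\<close> and the generators of \<open>H\<close>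
  through the lifts, because these letters generate \<open>F\<close>.\<close>

lemma finite_rel_presentation:
  assumes fp: "finitely_presented G" and "finite S" and gen: "generate G (S \<union> H) = carrier G"
    and Y: "finite Y" "Y \<subseteq> H" "generate G Y = H"
  obtains R where "finite R" "rel_presentation G H S R"
proof -
  interpret h: group_hom F G "rel_hom G" by (rule rel_hom_group_hom)
  let ?\<theta> = "rel_hom G"
  obtain T :: "nat set" and R0 \<phi> where T: "finite T" "finite R0" "R0 \<subseteq> carrier (free_group T)"
    and \<phi>: "\<phi> \<in> hom (free_group T) G" "\<phi> ` carrier (free_group T) = carrier G"
    "kernel (free_group T) G \<phi> = normal_closure (free_group T) R0"
    using finitely_presented_hom[OF G fp] by metis
  let ?T = "free_group T"
  interpret T: group ?T by (rule free_group_group)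
  interpret \<phi>: group_hom ?T G \<phi> using \<phi>(1) by unfold_locales
  \<comment> \<open>Lifts of the generators of \<open>G\<close> along the natural map; they define
    \<open>\<psi>\<close> with \<open>?\<theta> \<circ> \<psi> = \<phi>\<close> on the free
    group.\<close>
  have "\<forall>t \<in> T. \<exists>x \<in> carrier F. ?\<theta> x = \<phi> (free_group_gen T t)"
    using rel_hom_surj[OF gen] by (metis \<phi>.hom_closed free_group_gen_closed image_iff)
  then obtain f where f: "\<And>t. t \<in> T \<Longrightarrow> f t \<in> carrier F \<and> ?\<theta> (f t) = \<phi> (free_group_gen T t)"
    by metis
  obtain \<psi> where \<psi>: "\<psi> \<in> hom ?T F" "\<And>t. t \<in> T \<Longrightarrow> \<psi> (free_group_gen T t) = f t"
    using free_group_lift[of F f T] f F.group_axioms by auto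
  interpret \<psi>: group_hom ?T F \<psi> using \<psi>(1) by unfold_locales
  have \<theta>\<psi>: "?\<theta> (\<psi> x) = \<phi> x" if "x \<in> carrier ?T" for x
  proof -
    have "?\<theta> \<circ> \<psi> \<in> hom ?T G" using Group.hom_compose[OF \<psi>(1) h.homh] .
    moreover have "free_group_gen T ` T \<subseteq> carrier ?T" by auto
    moreover have "\<phi> z = (?\<theta> \<circ> \<psi>) z" if "z \<in> free_group_gen T ` T" for z
      using that f \<psi>(2) by auto
    moreover have "x \<in> generate ?T (free_group_gen T ` T)"
      using that carrier_free_group[of T] by blast
    ultimately have "\<phi> x = (?\<theta> \<circ> \<psi>) x" by (rule \<phi>.eq_on_generate)
    then show ?thesis by simp
  qed
  define Z where "Z = (\<lambda>s. cl [Gen s True]) ` S \<union> (\<lambda>y. cl [Sub y]) ` Y"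
  have Z: "finite Z" "Z \<subseteq> carrier F"
    using assms(2) Y(1,2) by (auto simp: Z_def intro!: rel_class_closed)
  have "\<forall>z \<in> Z. \<exists>v \<in> carrier ?T. \<phi> v = ?\<theta> z"
    using \<phi>(2) Z(2) by (metis h.hom_closed image_iff subsetD)
  then obtain v where v: "\<And>z. z \<in> Z \<Longrightarrow> v z \<in> carrier ?T \<and> \<phi> (v z) = ?\<theta> z"
    by metis
  define R where "R = \<psi> ` R0 \<union> (\<lambda>z. z \<otimes>\<^bsub>F\<^esub> inv\<^bsub>F\<^esub> \<psi> (v z)) ` Z"
  let ?N = "normal_closure F R"
  have RF: "R \<subseteq> carrier F" using T(3) Z(2) v by (auto simp: R_def)
  interpret N: normal ?N F using F.normal_normal_closure[OF RF] .
  have R0_ker: "\<phi> r = \<one>" if "r \<in> R0" for r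
    using \<phi>(3) normal_closure_incl[of R0 ?T] that by (auto simp: kernel_def)
  have "R \<subseteq> kernel F G ?\<theta>"
    using RF T(3) Z(2) v R0_ker by (auto simp: R_def kernel_def \<theta>\<psi> subset_iff)
  then have le: "?N \<subseteq> kernel F G ?\<theta>"
    by (rule normal_closure_minimal[OF h.normal_kernel])
  have "kernel F G ?\<theta> \<subseteq> ?N"
  proof
    fix x assume x: "x \<in> kernel F G ?\<theta>"
    \<comment> \<open>Modulo \<open>?N\<close> each element of \<open>Z\<close> equals an element of
      the image of \<open>\<psi>\<close>, so this product is all of \<open>F\<close>.\<close>
    let ?I = "?N <#>\<^bsub>F\<^esub> \<psi> ` carrier ?T"
    have I: "subgroup ?I F"
      using F.mult_norm_subgroup[OF N.normal_axioms \<psi>.img_is_subgroup] .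
    have ZI: "z \<in> ?I" if "z \<in> Z" for z
    proof -
      have "z = (z \<otimes>\<^bsub>F\<^esub> inv\<^bsub>F\<^esub> \<psi> (v z)) \<otimes>\<^bsub>F\<^esub> \<psi> (v z)"
        using that Z(2) v by (simp add: F.m_assoc subsetD)
      moreover have "z \<otimes>\<^bsub>F\<^esub> inv\<^bsub>F\<^esub> \<psi> (v z) \<in> ?N"
        using that normal_closure_incl[of R F] by (auto simp: R_def)
      ultimately show ?thesis using v that unfolding set_mult_def by blast
    qed
    have "?I = carrier F"
      by (rule subgroup_rel_free_eq[OF I Y(2,3)]) (auto intro!: ZI simp: Z_def)
    then have "x \<in> ?I" using x by (simp add: kernel_def)
    then obtain n t where nt: "n \<in> ?N" "t \<in> carrier ?T" "x = n \<otimes>\<^bsub>F\<^esub> \<psi> t"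
      unfolding set_mult_def by blast
    have "\<phi> t = \<one>"
      using nt x le \<theta>\<psi>[of t] by (auto simp: kernel_def)
    then have "t \<in> normal_closure ?T R0"
      using nt(2) by (simp add: kernel_def flip: \<phi>(3))
    \<comment> \<open>The preimage of \<open>?N\<close> under \<open>\<psi>\<close> is normal and
      contains \<open>R0\<close>, because \<open>\<psi>\<close> maps \<open>R0\<close> into
      \<open>R\<close>.\<close>
    moreover have "normal_closure ?T R0 \<subseteq> {t \<in> carrier ?T. \<psi> t \<in> ?N}"
    proof (rule normal_closure_minimal)
      show "{t \<in> carrier ?T. \<psi> t \<in> ?N} \<lhd> ?T"
        unfolding T.normal_inv_iff
        by (auto intro!: T.subgroupI exI[of _ "\<one>\<^bsub>?T\<^esub>"] simp: N.inv_op_closed2)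
      show "R0 \<subseteq> {t \<in> carrier ?T. \<psi> t \<in> ?N}"
        using T(3) normal_closure_incl[of R F] by (auto simp: R_def)
    qed
    ultimately show "x \<in> ?N" using nt by auto
  qed
  then have "rel_presentation G H S R"
    unfolding rel_presentation_def using S RF rel_hom_surj[OF gen] le by blast
  moreover have "finite R" using T(2) Z(1) by (simp add: R_def)
  ultimately show thesis using that by blast
qed

end

section \<open>Areas of words\<close>

text \<open>Area at most \<open>k\<close>, in the sense of \<open>rel_dehn\<close>. As a predicate
  it needs no value for elements that are not products of conjugates of relators.\<close>

definition area_le :: "('f, 'm) monoid_scheme \<Rightarrow> 'f set \<Rightarrow> nat \<Rightarrow> 'f \<Rightarrow> bool" where
  "area_le F R k x \<longleftrightarrow> (\<exists>ps. set ps \<subseteq> carrier F \<times> (R \<union> m_inv F ` R) \<and> x = conj_prod F ps \<and> length ps \<le> k)"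

context group
begin

lemma cancel_inv_left:
  "x \<in> carrier G \<Longrightarrow> y \<in> carrier G \<Longrightarrow> inv x \<otimes> (x \<otimes> y) = y"
  by (simp flip: m_assoc)

lemma conj_prod_Cons: "conj_prod G ((f, r) # ps) = (inv f \<otimes> r \<otimes> f) \<otimes> conj_prod G ps"
  and conj_prod_Nil: "conj_prod G [] = \<one>"
  by (simp_all add: conj_prod_def)

lemma area_le_mono: "area_le G R k x \<Longrightarrow> k \<le> l \<Longrightarrow> area_le G R l x"
  unfolding area_le_def by (elim exE conjE, intro exI conjI) (assumption | erule order_trans)+

lemma conj_prod_closed: "set ps \<subseteq> carrier G \<times> carrier G \<Longrightarrow> conj_prod G ps \<in> carrier G"
  by (induction ps) (auto simp: conj_prod_Cons conj_prod_Nil)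

lemma conj_prod_append:
  "set ps \<subseteq> carrier G \<times> carrier G \<Longrightarrow> set qs \<subseteq> carrier G \<times> carrier G \<Longrightarrow>
    conj_prod G (ps @ qs) = conj_prod G ps \<otimes> conj_prod G qs"
  by (induction ps) (auto simp: conj_prod_Cons conj_prod_Nil conj_prod_closed m_assoc)

text \<open>Conjugation by \<open>g\<close> is absorbed into each conjugator, so the number of
  factors stays the same.\<close>

lemma conj_prod_conj:
  assumes "set ps \<subseteq> carrier G \<times> carrier G" and g: "g \<in> carrier G"
  shows "conj_prod G (map (\<lambda>(f, r). (f \<otimes> inv g, r)) ps) = g \<otimes> conj_prod G ps \<otimes> inv g"
  using assms(1)
proof (induction ps)
  case (Cons p ps)
  obtain f r where p: "p = (f, r)" by (cases p)
  then have c: "f \<in> carrier G" "r \<in> carrier G" "conj_prod G ps \<in> carrier G"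
    using Cons.prems conj_prod_closed by auto
  have "inv (f \<otimes> inv g) \<otimes> r \<otimes> (f \<otimes> inv g) \<otimes> (g \<otimes> conj_prod G ps \<otimes> inv g) =
      g \<otimes> (inv f \<otimes> r \<otimes> f \<otimes> conj_prod G ps) \<otimes> inv g"
    using c g by (simp add: inv_mult_group m_assoc inv_solve_left')
  then show ?case
    using Cons p by (simp add: conj_prod_Cons)
qed (simp add: conj_prod_Nil g)

lemma conj_prod_inv:
  assumes "set ps \<subseteq> carrier G \<times> carrier G"
  shows "conj_prod G (rev (map (\<lambda>(f, r). (f, inv r)) ps)) = inv (conj_prod G ps)"
  using assms
proof (induction ps)
  case (Cons p ps)
  obtain f r where p: "p = (f, r)" by (cases p)
  then have c: "f \<in> carrier G" "r \<in> carrier G" "conj_prod G ps \<in> carrier G"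
    using Cons.prems conj_prod_closed by auto
  have "set (rev (map (\<lambda>(f, r). (f, inv r)) ps)) \<subseteq> carrier G \<times> carrier G"
    using Cons.prems by auto
  then show ?case
    using Cons p c by (simp add: conj_prod_Cons conj_prod_Nil conj_prod_append inv_mult_group m_assoc)
qed (simp add: conj_prod_Nil)

lemma area_le_mult:
  assumes R: "R \<subseteq> carrier G" and "area_le G R k x" "area_le G R l y"
  shows "area_le G R (k + l) (x \<otimes> y)"
proof -
  obtain ps qs where *: "set ps \<subseteq> carrier G \<times> (R \<union> m_inv G ` R)" "x = conj_prod G ps" "length ps \<le> k"
    "set qs \<subseteq> carrier G \<times> (R \<union> m_inv G ` R)" "y = conj_prod G qs" "length qs \<le> l"
    using assms(2,3) unfolding area_le_def by blast
  have "R \<union> m_inv G ` R \<subseteq> carrier G" using R by auto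
  then have "set ps \<subseteq> carrier G \<times> carrier G" "set qs \<subseteq> carrier G \<times> carrier G" using * by blast+
  then show ?thesis
    using * unfolding area_le_def by (intro exI[of _ "ps @ qs"]) (simp add: conj_prod_append)
qed

text \<open>Cyclic rotations of a word are conjugate in \<open>F\<close>, so this allows a loop to
  be read from any of its vertices.\<close>

lemma area_le_conj:
  assumes R: "R \<subseteq> carrier G" and "area_le G R k x" and g: "g \<in> carrier G"
  shows "area_le G R k (g \<otimes> x \<otimes> inv g)"
proof -
  obtain ps where *: "set ps \<subseteq> carrier G \<times> (R \<union> m_inv G ` R)" "x = conj_prod G ps" "length ps \<le> k"
    using assms(2) unfolding area_le_def by blast
  have "R \<union> m_inv G ` R \<subseteq> carrier G" using R by auto
  then have "set ps \<subseteq> carrier G \<times> carrier G" using * by blast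
  then show ?thesis
    using * g unfolding area_le_def
    by (intro exI[of _ "map (\<lambda>(f, r). (f \<otimes> inv g, r)) ps"]) (auto simp: conj_prod_conj)
qed

lemma area_le_inv:
  assumes R: "R \<subseteq> carrier G" and "area_le G R k x"
  shows "area_le G R k (inv x)"
proof -
  obtain ps where *: "set ps \<subseteq> carrier G \<times> (R \<union> m_inv G ` R)" "x = conj_prod G ps" "length ps \<le> k"
    using assms(2) unfolding area_le_def by blast
  have "R \<union> m_inv G ` R \<subseteq> carrier G" using R by auto
  then have "set ps \<subseteq> carrier G \<times> carrier G" using * by blast
  moreover have "inv r \<in> R \<union> m_inv G ` R" if "r \<in> R \<union> m_inv G ` R" for r
    using that R by auto
  ultimately show ?thesis
    using * unfolding area_le_def
    by (intro exI[of _ "rev (map (\<lambda>(f, r). (f, inv r)) ps)"]) (fastforce simp: conj_prod_inv)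
qed

text \<open>The elements of finite area form a normal subgroup that contains
  \<open>R\<close>.\<close>

lemma normal_closure_area:
  assumes R: "R \<subseteq> carrier G" and "x \<in> normal_closure G R"
  shows "\<exists>k. area_le G R k x"
proof -
  let ?A = "{x. \<exists>k. area_le G R k x}"
  have RR: "R \<union> m_inv G ` R \<subseteq> carrier G" using R by auto
  have "?A \<subseteq> carrier G"
  proof
    fix x assume "x \<in> ?A"
    then obtain ps where "set ps \<subseteq> carrier G \<times> (R \<union> m_inv G ` R)" "x = conj_prod G ps"
      unfolding area_le_def by blast
    then show "x \<in> carrier G" using RR conj_prod_closed[of ps] by blast
  qed
  moreover have one: "area_le G R 0 \<one>"
    unfolding area_le_def by (auto simp: conj_prod_Nil)
  ultimately have "subgroup ?A G"
    using area_le_mult[OF R] area_le_inv[OF R] by (intro subgroupI) blast+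
  then have "?A \<lhd> G"
    using area_le_conj[OF R] unfolding normal_inv_iff by blast
  moreover have "area_le G R 1 r" if "r \<in> R" for r
    using that R unfolding area_le_def by (intro exI[of _ "[(\<one>, r)]"]) (auto simp: conj_prod_Cons conj_prod_Nil)
  then have "R \<subseteq> ?A" by blast
  ultimately show ?thesis
    using normal_closure_minimal[of ?A G R] assms(2) by blast
qed

end

section \<open>Cutting loops at a coset of \<open>H\<close>\<close>

context cayley
begin

text \<open>The last assumption says that no letter of \<open>H\<close> is read at a vertex in
  \<open>H\<close>, which is exactly when an edge would be missing from
  \<open>\<Gamma>'\<close>.\<close>

lemma word_path:
  assumes "S \<subseteq> X" "g \<in> carrier G" "w \<in> lists (letters S H)"
    "\<And>u h v. w = u @ Sub h # v \<Longrightarrow> g \<otimes> word_val G u \<notin> H"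
  shows "(g, g \<otimes> word_val G w) \<in> E' ^^ length w"
  using assms(2-)
proof (induction w arbitrary: g)
  case Nil
  then show ?case by (simp add: word_val_def)
next
  case (Cons a w)
  have SG: "S \<subseteq> carrier G" using assms(1) X by blast
  have a: "a \<in> letters X H" using Cons.prems(2) assms(1) by (cases a) auto
  have ac: "letter_val G a \<in> carrier G" using letter_closed[OF a] .
  have val: "word_val G (a # u) = letter_val G a \<otimes> word_val G u" for u
    by (simp add: word_val_def)
  have uc: "word_val G u \<in> carrier G" if "u \<in> lists (letters S H)" for u
    using word_val_closed[OF group_axioms H SG that] .
  have "a \<notin> Sub ` H" if "g \<in> H"
    using Cons.prems(3)[of "[]"] Cons.prems(1) that by (auto simp: word_val_def)
  then have "(g, g \<otimes> letter_val G a) \<in> E'"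
    using Cons.prems(1) a by (intro E'_I) auto
  moreover have "(g \<otimes> letter_val G a, g \<otimes> letter_val G a \<otimes> word_val G w) \<in> E' ^^ length w"
  proof (rule Cons.IH)
    fix u h v assume w: "w = u @ Sub h # v"
    then have "u \<in> lists (letters S H)" using Cons.prems(2) by auto
    then show "g \<otimes> letter_val G a \<otimes> word_val G u \<notin> H"
      using Cons.prems(3)[of "a # u" h v] w Cons.prems(1) ac uc by (simp add: val m_assoc)
  qed (use Cons.prems ac in auto)
  ultimately show ?case
    using Cons.prems ac uc[of w] by (auto simp: val m_assoc intro: relpow_Suc_I2 simp del: relpow.simps(2))
qed

text \<open>The alphabet includes \<open>Sub \<one>\<close>, unlike that of \<open>rel_dehn\<close>:
  cutting a loop may produce trivial letters, and the induction has to cover the resulting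
  words.\<close>

lemma bounded_area:
  assumes S: "finite S" "S \<subseteq> X" and fin: "\<And>n. finite {k \<in> H. rel_dist G X H \<one> k \<le> enat n}"
    and R: "rel_presentation G H S R"
  shows "\<exists>K. \<forall>w \<in> lists (letters S H). length w \<le> n \<and> word_val G w = \<one> \<longrightarrow>
    area_le (rel_free G H S) R K (rel_class G H S w)"
proof (induction n)
  case 0
  have "area_le (rel_free G H S) R 0 (rel_class G H S [])"
    using rel_class_Nil[OF group_axioms H] S X unfolding area_le_def
    by (intro exI[of _ "[]"]) (auto simp: conj_prod_def)
  then show ?case by (intro exI[of _ 0]) auto
next
  case (Suc n)
  have SG: "S \<subseteq> carrier G" using S X by blast
  let ?F = "rel_free G H S" and ?c = "rel_class G H S" and ?L = "lists (letters S H)"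
  interpret F: group ?F by (rule rel_free_group[OF group_axioms H])
  have RF: "R \<subseteq> carrier ?F" using R by (simp add: rel_presentation_def)
  note closed = rel_class_closed[OF group_axioms H SG]
  note val_closed = word_val_closed[OF group_axioms H SG]
  note val_append = word_val_append[OF group_axioms H SG]
  obtain K where K: "\<And>w. w \<in> ?L \<Longrightarrow> length w \<le> n \<Longrightarrow> word_val G w = \<one> \<Longrightarrow> area_le ?F R K (?c w)"
    using Suc.IH by blast
  \<comment> \<open>After the letter \<open>h\<close>, the rest of the loop has length at most
    \<open>n\<close> and value \<open>inv h\<close>; hence the inverse in this condition.\<close>
  define B where "B = {h \<in> H. rel_dist G X H \<one> (inv h) \<le> enat n}"
  have "finite ((\<lambda>h. inv h) ` {k \<in> H. rel_dist G X H \<one> k \<le> enat n})"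
    using fin by blast
  moreover have "B \<subseteq> (\<lambda>h. inv h) ` {k \<in> H. rel_dist G X H \<one> k \<le> enat n}"
  proof
    fix h assume "h \<in> B"
    then show "h \<in> (\<lambda>h. inv h) ` {k \<in> H. rel_dist G X H \<one> k \<le> enat n}"
      using subgroup.m_inv_closed[OF H] H_closed by (intro image_eqI[of _ _ "inv h"]) (auto simp: B_def)
  qed
  ultimately have finB: "finite B" by (rule finite_subset[rotated])
  define W where "W = {w. set w \<subseteq> letters S B \<and> length w \<le> Suc n}"
  have "letters S B = (\<lambda>(s, b). Gen s b) ` (S \<times> UNIV) \<union> Sub ` B"
    by (auto simp: letters_def)
  then have "finite (letters S B)" using S(1) finB by simp
  then have finW: "finite W" unfolding W_def by (rule finite_lists_length_le)
  have "\<exists>k. area_le ?F R k (?c w)" if w: "w \<in> ?L" "word_val G w = \<one>" for w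
  proof -
    have "?c w \<in> kernel ?F G (rel_hom G)"
      using w closed rel_hom_class[OF group_axioms H SG] by (simp add: kernel_def)
    then show ?thesis
      using R F.normal_closure_area[OF RF] by (simp add: rel_presentation_def)
  qed
  then obtain k where k: "\<And>w. w \<in> ?L \<Longrightarrow> word_val G w = \<one> \<Longrightarrow> area_le ?F R (k w) (?c w)"
    by metis
  \<comment> \<open>The sum dominates \<open>k w\<close> for each of the finitely many words over
    small letters; \<open>K + K\<close> serves the words that are cut into two.\<close>
  define M where "M = (\<Sum>w\<in>W. k w) + (K + K)"
  have "area_le ?F R M (?c w)" if w: "w \<in> ?L" "length w \<le> Suc n" "word_val G w = \<one>" for w
  proof (cases "w \<in> W")
    case True
    then have "k w \<le> M" using member_le_sum[OF True, of k] finW by (simp add: M_def)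
    then show ?thesis using F.area_le_mono[OF k[OF w(1,3)]] by blast
  next
    case False
    then obtain a where a: "a \<in> set w" "a \<notin> letters S B" using w(2) by (auto simp: W_def)
    have "a \<in> letters S H" using a(1) w(1) by auto
    then obtain h where h: "a = Sub h" "h \<in> H" "h \<notin> B"
      using a(2) by (auto simp: letters_def)
    obtain u v where uv: "w = u @ Sub h # v" using a h by (metis split_list)
    have uvL: "u \<in> ?L" "v \<in> ?L" using uv w(1) by auto
    have hc: "h \<in> carrier G" using H_closed h by blast
    \<comment> \<open>The loop is rotated so that it starts with \<open>h\<close>, and
      \<open>x\<close> is what remains.\<close>
    define x where "x = v @ u"
    have xL: "x \<in> ?L" and xlen: "length x \<le> n" using uvL uv w(2) by (auto simp: x_def)
    have Sub_val: "word_val G (Sub j # y) = j \<otimes> word_val G y" for j y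
      by (simp add: word_val_def)
    have "word_val G u \<otimes> (h \<otimes> word_val G v) = \<one>"
      using w(3) uvL h val_append by (simp add: uv Sub_val)
    then have "h \<otimes> word_val G v \<otimes> word_val G u = \<one>"
      using inv_comm val_closed uvL hc by blast
    then have hx: "h \<otimes> word_val G x = \<one>"
      using hc val_closed uvL val_append by (simp add: x_def m_assoc)
    then have xval: "word_val G x = inv h"
      using hc val_closed[OF xL] by (metis inv_comm inv_equality)
    \<comment> \<open>Otherwise \<open>x\<close> would label a path in \<open>\<Gamma>'\<close> from
      \<open>\<one>\<close> to \<open>inv h\<close>, and \<open>h\<close> would belong to
      \<open>B\<close>.\<close>
    have "\<exists>y j z. x = y @ Sub j # z \<and> word_val G y \<in> H"
    proof (rule ccontr)
      assume no: "\<nexists>y j z. x = y @ Sub j # z \<and> word_val G y \<in> H"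
      have "(\<one>, \<one> \<otimes> word_val G x) \<in> E' ^^ length x"
      proof (rule word_path[OF S(2) one_closed xL])
        fix y j z assume "x = y @ Sub j # z"
        then show "\<one> \<otimes> word_val G y \<notin> H"
          using no val_closed[of y] xL by auto
      qed
      then have "rel_dist G X H \<one> (inv h) \<le> enat n"
        using rel_dist_le[OF subgroup.one_closed[OF H]] xlen xval hc by auto
      then show False using h by (simp add: B_def)
    qed
    then obtain y j z where x: "x = y @ Sub j # z" and c: "word_val G y \<in> H" by blast
    define c where "c = word_val G y"
    have cH: "c \<in> H" using \<open>word_val G y \<in> H\<close> by (simp add: c_def)
    have yz: "y \<in> ?L" "z \<in> ?L" "j \<in> H" using xL x by auto
    note HG = cH[THEN H_closed] yz(3)[THEN H_closed] hc
    note HH = subgroup.m_closed[OF H] subgroup.m_inv_closed[OF H]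
    \<comment> \<open>First piece: \<open>y\<close> leads from \<open>\<one>\<close> to
      \<open>c\<close>, and a single letter closes it up. This letter replaces \<open>Sub j\<close>,
      which \<open>x\<close> contains besides \<open>y\<close>, so the length stays at most
      \<open>n\<close>.\<close>
    have 1: "area_le ?F R K (?c (y @ [Sub (inv c)]))"
    proof (rule K)
      show "y @ [Sub (inv c)] \<in> ?L" using yz HH cH by simp
      show "word_val G (y @ [Sub (inv c)]) = \<one>"
        using val_append[OF yz(1), of "[Sub (inv c)]"] HH cH HG
        by (simp add: Sub_val c_def[symmetric]) (simp add: word_val_def)
      show "length (y @ [Sub (inv c)]) \<le> n" using xlen x by simp
    qed
    \<comment> \<open>Second piece: the edges labelled \<open>h\<close>, \<open>c\<close> and
      \<open>j\<close> lie in the same coset and merge into one letter, so this word is no longer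
      than \<open>x\<close>.\<close>
    have 2: "area_le ?F R K (?c (Sub (h \<otimes> c \<otimes> j) # z))"
    proof (rule K)
      show "Sub (h \<otimes> c \<otimes> j) # z \<in> ?L" using yz HH cH h by simp
      have "word_val G x = c \<otimes> (j \<otimes> word_val G z)"
        using yz val_append by (simp add: x Sub_val c_def)
      then show "word_val G (Sub (h \<otimes> c \<otimes> j) # z) = \<one>"
        using hx HG val_closed[OF yz(2)] by (simp add: Sub_val m_assoc)
      show "length (Sub (h \<otimes> c \<otimes> j) # z) \<le> n" using xlen x by simp
    qed
    have SubL: "i \<in> H \<Longrightarrow> [Sub i] \<in> ?L" for i by simp
    note cc = closed[OF yz(1)] closed[OF yz(2)] closed[OF uvL(1)] closed[OF uvL(2)]
      closed[OF SubL[OF h(2)]] closed[OF SubL[OF cH]] closed[OF SubL[OF yz(3)]]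
    note Cons = rel_class_Cons[OF group_axioms H SG]
    note append = rel_class_append[OF group_axioms H SG, symmetric]
    have e1: "?c (y @ [Sub (inv c)]) = ?c y \<otimes>\<^bsub>?F\<^esub> inv\<^bsub>?F\<^esub> ?c [Sub c]"
      using yz cH HH rel_class_Sub_inv[OF group_axioms H SG cH] by (simp add: append)
    have e2: "?c (Sub (h \<otimes> c \<otimes> j) # z) = ?c [Sub h] \<otimes>\<^bsub>?F\<^esub> ?c [Sub c] \<otimes>\<^bsub>?F\<^esub> ?c [Sub j] \<otimes>\<^bsub>?F\<^esub> ?c z"
      using yz cH h HH rel_class_Sub_mult[OF group_axioms H SG] Cons[of "Sub (h \<otimes> c \<otimes> j)" z] by simp
    have "?c [Sub h] \<otimes>\<^bsub>?F\<^esub> (?c v \<otimes>\<^bsub>?F\<^esub> ?c u) = ?c [Sub h] \<otimes>\<^bsub>?F\<^esub> (?c y \<otimes>\<^bsub>?F\<^esub> (?c [Sub j] \<otimes>\<^bsub>?F\<^esub> ?c z))"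
    proof -
      have "?c v \<otimes>\<^bsub>?F\<^esub> ?c u = ?c x" using uvL by (simp add: x_def append)
      also have "\<dots> = ?c y \<otimes>\<^bsub>?F\<^esub> (?c [Sub j] \<otimes>\<^bsub>?F\<^esub> ?c z)" using yz Cons[of "Sub j" z] by (simp add: x append)
      finally show ?thesis by simp
    qed
    \<comment> \<open>the loop is cut along the edge from \<open>h\<close> to \<open>h \<otimes> c\<close>\<close>
    also have "\<dots> = (?c [Sub h] \<otimes>\<^bsub>?F\<^esub> ?c (y @ [Sub (inv c)]) \<otimes>\<^bsub>?F\<^esub> inv\<^bsub>?F\<^esub> ?c [Sub h])
        \<otimes>\<^bsub>?F\<^esub> ?c (Sub (h \<otimes> c \<otimes> j) # z)"
      unfolding e1 e2 using cc by (simp add: F.m_assoc F.cancel_inv_left)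
    finally have rot: "area_le ?F R (K + K) (?c [Sub h] \<otimes>\<^bsub>?F\<^esub> (?c v \<otimes>\<^bsub>?F\<^esub> ?c u))"
      using F.area_le_mult[OF RF F.area_le_conj[OF RF 1] 2] cc by simp
    \<comment> \<open>The rotation is undone: \<open>w\<close> is the conjugate by \<open>u\<close>
      of the rotated word.\<close>
    have "?c w = ?c u \<otimes>\<^bsub>?F\<^esub> (?c [Sub h] \<otimes>\<^bsub>?F\<^esub> (?c v \<otimes>\<^bsub>?F\<^esub> ?c u)) \<otimes>\<^bsub>?F\<^esub> inv\<^bsub>?F\<^esub> ?c u"
      using uvL h cc Cons[of "Sub h" v] by (simp add: uv append F.m_assoc)
    then have "area_le ?F R (K + K) (?c w)"
      using F.area_le_conj[OF RF rot cc(3)] by simp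
    then show ?thesis
      by (rule F.area_le_mono) (simp add: M_def)
  qed
  then show ?case by blast
qed

text \<open>Since \<open>rel_dehn\<close> is a least element of \<open>enat\<close>, one finite
  bound common to all words of length at most \<open>n\<close> suffices.\<close>

lemma rel_dehn_finite:
  assumes "finite S" "S \<subseteq> X" "\<And>n. finite {k \<in> H. rel_dist G X H \<one> k \<le> enat n}"
    and "rel_presentation G H S R"
  shows "rel_dehn G H S R n \<noteq> \<infinity>"
proof -
  obtain K where K: "\<And>w. w \<in> lists (letters S H) \<Longrightarrow> length w \<le> n \<Longrightarrow> word_val G w = \<one> \<Longrightarrow>
      area_le (rel_free G H S) R K (rel_class G H S w)"
    using bounded_area[OF assms] by blast
  have sub: "lists (letters S (H - {\<one>})) \<subseteq> lists (letters S H)"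
    by (rule lists_mono) (auto simp: letters_def)
  have "rel_dehn G H S R n \<le> enat K"
    unfolding rel_dehn_def Let_def
  proof (rule Least_le, intro ballI impI, elim conjE)
    fix w assume w: "w \<in> lists (letters S (H - {\<one>}))" "length w \<le> n" "word_val G w = \<one>"
    then obtain ps where "set ps \<subseteq> carrier (rel_free G H S) \<times> (R \<union> m_inv (rel_free G H S) ` R)"
      "rel_class G H S w = conj_prod (rel_free G H S) ps" "length ps \<le> K"
      using K[of w] sub unfolding area_le_def by blast
    then show "\<exists>ps. set ps \<subseteq> carrier (rel_free G H S) \<times> (R \<union> m_inv (rel_free G H S) ` R) \<and>
        rel_class G H S w = conj_prod (rel_free G H S) ps \<and> enat (length ps) \<le> enat K"
      by auto
  qed
  then show ?thesis using enat_ile by force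
qed

end

section \<open>Choice of a finite relative presentation\<close>

theorem theorem7:
  fixes G :: "('a, 'm) monoid_scheme" and H :: "'a set"
  assumes "group G"
    and "finitely_presented G"
    and "subgroup H G"
    and "hyp_embedded G H"
  shows "rel_dehn_well_defined G H"
proof -
  interpret group G by fact
  obtain X where X': "X \<subseteq> carrier G" "generate G (X \<union> H) = carrier G"
    and hyp: "hyperbolic_graph (cayley_graph G X H)"
    and "\<forall>h \<in> H. \<forall>n. finite {k \<in> H. rel_dist G X H h k \<le> enat n}"
    using assms(4) by (auto simp: hyp_embedded_def hyp_embedded_wrt_def)
  then have fin: "finite {k \<in> H. rel_dist G X H \<one>\<^bsub>G\<^esub> k \<le> enat n}" for n
    using subgroup.one_closed[OF assms(3)] by blast
  interpret cayley G H X
    using X' assms(3) by (intro cayley.intro cayley_axioms.intro group_axioms)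
  obtain T :: "nat set" and \<phi> where T: "finite T"
    and \<phi>: "\<phi> \<in> hom (free_group T) G" "\<phi> ` carrier (free_group T) = carrier G"
    using finitely_presented_hom[OF assms(1,2)] by metis
  interpret \<phi>: group_hom "free_group T" G \<phi>
    using \<phi>(1) free_group_group by (simp add: group_hom_def group_hom_axioms_def group_axioms)
  \<comment> \<open>A finite generating set of \<open>G\<close>; writing its elements through
    \<open>X \<union> H\<close> yields the finite set \<open>Z\<close>.\<close>
  let ?A = "\<phi> ` free_group_gen T ` T"
  have "?A \<subseteq> carrier G" by auto
  then obtain Z where Z: "finite Z" "Z \<subseteq> X \<union> H" "?A \<subseteq> generate G Z"
    using finite_subset_generate[of ?A "X \<union> H"] T X' by auto
  have ZG: "Z \<subseteq> carrier G" using Z(2) X' H_closed by blast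
  have "free_group_gen T ` T \<subseteq> carrier (free_group T)" by auto
  then have "carrier G = generate G ?A"
    using \<phi>.generate_img \<phi>(2) carrier_free_group[of T] by metis
  also have "\<dots> \<subseteq> generate G Z"
    using generate_subgroup_incl[OF Z(3) generate_is_subgroup[OF ZG]] .
  finally have genZ: "generate G Z = carrier G" using generate_incl[OF ZG] by blast
  obtain Y where Y: "finite Y" "Y \<subseteq> H" "generate G Y = H"
    using finitely_generated_subgroup[OF hyp fin Z(1,2) genZ] .
  \<comment> \<open>The relative generators are taken from \<open>X\<close> so that words over them
    label paths in \<open>\<Gamma>\<close>, as \<open>rel_dehn_finite\<close> requires; the other
    elements of \<open>Z\<close> lie in \<open>H\<close>.\<close>
  let ?S = "Z \<inter> X"
  have S: "finite ?S" "?S \<subseteq> X" "?S \<subseteq> carrier G" using Z X' by auto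
  have "Z \<subseteq> ?S \<union> H" "?S \<union> H \<subseteq> carrier G" using Z(2) S(3) H_closed by auto
  then have "generate G (?S \<union> H) = carrier G"
    using mono_generate[of Z "?S \<union> H"] genZ generate_incl[of "?S \<union> H"] by blast
  then obtain R where R: "finite R" "rel_presentation G H ?S R"
    using finite_rel_presentation[OF assms(1,3) S(3) assms(2) S(1) _ Y] by blast
  then show ?thesis
    unfolding rel_dehn_well_defined_def
    using S(1) rel_dehn_finite[OF S(1,2) fin R(2)] by blast
qed

end
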